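(* Let $n,p$ be positive integers with $p\le n$, and let $X_1,\dots,X_{n+1}$ be i.i.d. random vectors with distribution $\mathcal{N}_p(\mu,\Sigma)$, where $\mu\in\mathbb{R}^p$ and $\Sigma$ is a $p\times p$ positive definite matrix. Let $\hat T=\log\det\hat\Sigma-\tau_{n,p}$. Then $$\mathbb{E}\left(\hat T-\log\det\Sigma\right)^2\le -2\log\left(1-\frac pn\right)+\frac{10p}{3n}\cdot\frac{1}{n-p},$$ where the right-hand side is interpreted as $+\infty$ when $p=n$.
   Context: The sample covariance matrix is $\hat\Sigma=\frac1n\sum_{k=1}^{n+1}(X_k-\bar X)(X_k-\bar X)^T$, where $\bar X=\frac{1}{n+1}\sum_{k=1}^{n+1}X_k$. The bias correction constant is $$\tau_{n,p}=\sum_{k=1}^p\left[\psi\left(\frac{n-k+1}{2}\right)-\log\left(\frac n2\right)\right],$$ where $\psi(x)=\frac{d}{dx}\log\Gamma(x)$ is the digamma function. *)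

theory Defs
  imports "HOL-Probability.Probability"
begin

definition positive_definite :: "real^'p^'p \<Rightarrow> bool" where
  "positive_definite A \<longleftrightarrow> transpose A = A \<and> (\<forall>x. x \<noteq> 0 \<longrightarrow> x \<bullet> (A *v x) > 0)"

text \<open>Lebesgue density of the nondegenerate normal distribution on \<open>real^'p\<close> with mean \<open>\<mu>\<close>
  and covariance matrix \<open>\<Sigma>\<close>; meaningful only for positive definite \<open>\<Sigma>\<close>.\<close>

definition mvnormal_density :: "real^'p \<Rightarrow> real^'p^'p \<Rightarrow> real^'p \<Rightarrow> real" where
  "mvnormal_density \<mu> \<Sigma> x =
     1 / sqrt ((2 * pi) ^ CARD('p) * det \<Sigma>) *
     exp (- ((x - \<mu>) \<bullet> (matrix_inv \<Sigma> *v (x - \<mu>))) / 2)"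

definition outer_product :: "real^'p \<Rightarrow> real^'p \<Rightarrow> real^'p^'p" where
  "outer_product x y = (\<chi> i j. x $ i * y $ j)"

text \<open>In the following, a sample consists of the \<open>n + 1\<close> vectors \<open>x 1, \<dots>, x (n + 1)\<close>;
  the value \<open>x 0\<close> is not part of it.\<close>

definition sample_mean :: "nat \<Rightarrow> (nat \<Rightarrow> real^'p) \<Rightarrow> real^'p" where
  "sample_mean n x = (1 / real (n + 1)) *\<^sub>R (\<Sum>k = 1..n + 1. x k)"

definition sample_covariance :: "nat \<Rightarrow> (nat \<Rightarrow> real^'p) \<Rightarrow> real^'p^'p" where
  "sample_covariance n x =
     (1 / real n) *\<^sub>R
       (\<Sum>k = 1..n + 1. outer_product (x k - sample_mean n x) (x k - sample_mean n x))"

definition bias_correction :: "nat \<Rightarrow> nat \<Rightarrow> real" where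
  "bias_correction n p =
     (\<Sum>k = 1..p. Digamma ((real n - real k + 1) / 2) - ln (real n / 2))"

text \<open>The convention \<open>ln 0 = 0\<close> comes into play only where the sample covariance is singular,
  which for normal samples with \<open>CARD('p) \<le> n\<close> is a null event.\<close>

definition log_det_estimator :: "nat \<Rightarrow> (nat \<Rightarrow> real^'p) \<Rightarrow> real" where
  "log_det_estimator n x = ln (det (sample_covariance n x)) - bias_correction n CARD('p)"

end

theory Submission
  imports Defs "HOL-Real_Asymp.Real_Asymp"
begin

text \<open>
  Whitening by a matrix that is orthonormal with respect to \<open>\<Sigma>\<close> turns the error of the estimator into
  \<open>ln d - m\<close>, where \<open>d\<close> is the determinant of the centred scatter matrix of a standard Gaussian sample
  and \<open>m\<close> is a constant.  The classical route is Bartlett's decomposition: \<open>d\<close> is distributed like a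
  product of independent chi-square variables with \<open>n, n - 1, \<dots>, n - p + 1\<close> degrees of freedom, hence
  \<open>ln d\<close> has mean \<open>m\<close>, its variance is the sum of the trigamma values at half these degrees, and
  bounds for the trigamma function finish the proof.

  Here the decomposition is only needed in its Mellin form
  \<open>E d\<^sup>s = (\<Prod>k<p. 2\<^sup>s \<Gamma>(a\<^sub>k + s) / \<Gamma>(a\<^sub>k))\<close> with \<open>a\<^sub>k = (n - k) / 2\<close> for small positive and negative \<open>s\<close>
  (\<open>mellin_wishart\<close>).  No moment of a logarithm has to be computed: integrating the pointwise inequality
  \<open>x\<^sup>2 + 2 \<le> e\<^sup>x + e\<^bsup>-x\<^esup>\<close> at \<open>x = s (ln d - m)\<close> bounds the mean square error by
  \<open>(exp (g s) + exp (g (- s)) - 2) / s\<^sup>2\<close>, where \<open>g\<close> is the logarithm of the Mellin transform of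
  \<open>d / e\<^sup>m\<close>.  Since \<open>g\<close> vanishes at \<open>0\<close> together with its first derivative (this is what the bias
  correction achieves), the limit \<open>s \<rightarrow> 0\<close> gives \<open>g'' 0\<close>, which is the sum of trigamma values.

  Both reductions of the scatter matrix, the centring of the sample and the removal of one coordinate
  from the determinant, are instances of one statement about regression through the origin
  (\<open>nn_integral_regress\<close>).  If the pairs \<open>(x\<^sub>k, Y\<^sub>k)\<close> are independent and identically
  distributed, and \<open>x\<^sub>k\<close> is almost surely nonzero and independent of the standard Gaussian vector \<open>Y\<^sub>k\<close>, then the residual scatter matrix \<open>\<Sum> Y\<^sub>k Y\<^sub>k\<^sup>T - (\<Sum> x\<^sub>k Y\<^sub>k) (\<Sum> x\<^sub>k Y\<^sub>k)\<^sup>T / \<Sum> x\<^sub>k\<^sup>2\<close> is independent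
  of \<open>\<Sum> x\<^sub>k\<^sup>2\<close> and distributed like the scatter matrix of one observation less.  It follows by
  induction on the sample size from the invariance of a pair of independent Gaussian vectors under plane rotations.
  With \<open>x\<^sub>k = 1\<close> it describes centring (\<open>centred_scatter_wishart\<close>), with Gaussian \<open>x\<^sub>k\<close> and a Schur
  complement it peels one chi-square factor off the determinant (\<open>mellin_wishart_insert\<close>).
\<close>

section \<open>Bounds for sums of trigamma values\<close>

text \<open>
  The right-hand side \<open>h\<close> satisfies \<open>h y - h (y + 1) \<ge> 1 / y\<^sup>2\<close> with error exactly
  \<open>1 / (6 y\<^sup>3 (y + 1)\<^sup>3)\<close>, and \<open>h\<close> tends to \<open>0\<close>; so its telescoping series dominates the
  series \<open>\<Sum> 1 / (x + k)\<^sup>2\<close> of the trigamma function term by term.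
\<close>

lemma trigamma_upper_bound:
  fixes x :: real
  assumes "x > 0"
  shows "Polygamma 1 x \<le> 1 / x + 1 / (2 * x^2) + 1 / (6 * x^3)"
proof -
  define h where "h y = 1 / y + 1 / (2 * y^2) + 1 / (6 * y^3)" for y :: real
  have lim: "(\<lambda>k. h (x + real k)) \<longlonglongrightarrow> 0"
    unfolding h_def by real_asymp
  have step: "1 / y^2 \<le> h y - h (y + 1)" if "y > 0" for y
  proof -
    have frac: "h z = (6 * z^2 + 3 * z + 1) / (6 * z^3)" if "z > 0" for z
      using that unfolding h_def by (simp add: field_simps power2_eq_square power3_eq_cube)
    define z where "z = y + 1"
    have z: "z > 0" using that by (simp add: z_def)
    have "h y - h z - 1 / y^2
        = ((6 * y^2 + 3 * y + 1) * z^3 - (6 * z^2 + 3 * z + 1) * y^3 - 6 * y * z^3) / (6 * y^3 * z^3)"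
      unfolding frac[OF that] frac[OF z] using that z by (simp add: field_simps power2_eq_square power3_eq_cube)
    also have "(6 * y^2 + 3 * y + 1) * z^3 - (6 * z^2 + 3 * z + 1) * y^3 - 6 * y * z^3 = 1"
      unfolding z_def by algebra
    finally have "h y - h (y + 1) - 1 / y^2 = 1 / (6 * y^3 * (y + 1)^3)"
      by (simp add: z_def)
    also have "\<dots> \<ge> 0" using that by simp
    finally show ?thesis by simp
  qed
  have 1: "(\<lambda>k. inverse ((x + real k)^2)) sums Polygamma 1 x"
    using Polygamma_LIMSEQ[of x 1] assms by (simp add: numeral_2_eq_2)
  have 2: "(\<lambda>k. h (x + real k) - h (x + real (Suc k))) sums (h (x + real 0) - 0)"
    by (rule telescope_sums'[OF lim])
  have "Polygamma 1 x \<le> h (x + real 0) - 0"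
  proof (rule sums_le[OF _ 1 2])
    fix k
    show "inverse ((x + real k)^2) \<le> h (x + real k) - h (x + real (Suc k))"
      using step[of "x + real k"] assms by (simp add: field_simps)
  qed
  then show ?thesis by (simp add: h_def)
qed

text \<open>
  At \<open>m / 2\<close> the trigamma bound reads \<open>2 / m + 2 / m\<^sup>2 + 4 / (3 m\<^sup>3)\<close>.  The first term is compared with
  \<open>2 (ln m - ln (m - 1))\<close>, the other two with \<open>10 / 3 (1 / (m - 1) - 1 / m)\<close>, and both comparisons
  telescope.  The smallest \<open>m\<close> that occurs is \<open>n - p + 1 \<ge> 2\<close>.
\<close>

lemma sum_trigamma_upper_bound:
  assumes "p < n"
  shows "(\<Sum>k = 1..p. Polygamma 1 ((real n - real k + 1) / 2))
    \<le> - 2 * ln (1 - real p / real n) + 10 * real p / (3 * real n) * (1 / (real n - real p))"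
proof -
  have "(\<Sum>k = 1..p. Polygamma 1 ((real n - real k + 1) / 2))
      \<le> 2 * ln (real n) - 2 * ln (real n - real p) + 10 / 3 * (1 / (real n - real p) - 1 / real n)"
    using assms
  proof (induction p)
    case (Suc p)
    define m where "m = real n - real p"
    have m: "m \<ge> 2" using Suc.prems unfolding m_def by linarith
    have "Polygamma 1 (m / 2) \<le> 2 / m + 2 / m^2 + 4 / (3 * m^3)"
      using trigamma_upper_bound[of "m / 2"] m by (simp add: power_divide)
    also have "\<dots> \<le> 2 / m + 10 / 3 * (1 / (m - 1) - 1 / m)"
    proof -
      have "4 / (3 * m^3) \<le> 4 / (3 * m^2)"
        using m by (simp add: divide_simps power2_eq_square power3_eq_cube)
      then have "2 / m^2 + 4 / (3 * m^3) \<le> 10 / 3 * (1 / m^2)"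
        by (simp add: add_divide_distrib[symmetric])
      also have "\<dots> \<le> 10 / 3 * (1 / (m - 1) - 1 / m)"
        using m by (simp add: divide_simps power2_eq_square)
      finally show ?thesis by simp
    qed
    also have "2 / m \<le> 2 * (ln m - ln (m - 1))"
    proof -
      have "ln ((m - 1) / m) \<le> (m - 1) / m - 1"
        using m by (intro ln_le_minus_one) simp
      then have "ln (m - 1) - ln m \<le> - (1 / m)"
        using m by (simp add: ln_div divide_simps)
      then show ?thesis by simp
    qed
    finally have "Polygamma 1 (m / 2) \<le> 2 * (ln m - ln (m - 1)) + 10 / 3 * (1 / (m - 1) - 1 / m)"
      by simp
    moreover have "(real n - real (Suc p) + 1) / 2 = m / 2" "real n - real (Suc p) = m - 1"
      unfolding m_def by simp_all
    ultimately show ?case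
      using Suc unfolding m_def by (simp add: algebra_simps)
  qed simp
  also have "2 * ln (real n) - 2 * ln (real n - real p) = - 2 * ln (1 - real p / real n)"
  proof -
    have "1 - real p / real n = (real n - real p) / real n"
      using assms by (simp add: field_simps)
    then show ?thesis using assms by (simp add: ln_div)
  qed
  also have "10 / 3 * (1 / (real n - real p) - 1 / real n)
      = 10 * real p / (3 * real n) * (1 / (real n - real p))"
    using assms by (simp add: divide_simps) 
  finally show ?thesis by simp
qed

section \<open>From Mellin transforms to second moments\<close>

text \<open>
  This replaces all computations with moments of logarithms: it bounds a square by two
  exponentials, and it is sharp to second order at \<open>0\<close>.
\<close>

lemma square_le_exp_sum:
  fixes x :: real
  shows "x^2 + 2 \<le> exp x + exp (- x)"
proof -
  have *: "x^2 + 2 \<le> exp x + exp (- x)" if "x \<ge> 0" for x :: real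
  proof -
    define f where "f x = exp x + exp (- x) - x^2 - 2" for x :: real
    have "f 0 \<le> f x"
    proof (rule DERIV_nonneg_imp_nondecreasing[OF that])
      fix y :: real assume y: "0 \<le> y" "y \<le> x"
      have "(\<lambda>z. exp z - exp (- z) - 2 * z) 0 \<le> (\<lambda>z. exp z - exp (- z) - 2 * z :: real) y"
      proof (rule DERIV_nonneg_imp_nondecreasing[OF y(1)])
        fix z :: real
        have "exp z + exp (- z) - 2 = (exp (z/2) - exp (- z/2))^2"
          by (simp add: power2_diff exp_double[symmetric] exp_add[symmetric])
        then have "0 \<le> exp z + exp (- z) - 2" by simp
        then show "\<exists>y. ((\<lambda>z. exp z - exp (- z) - 2 * z) has_real_derivative y) (at z) \<and> 0 \<le> y"
          by (intro exI[of _ "exp z + exp (- z) - 2"]) (auto intro!: derivative_eq_intros)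
      qed
      then show "\<exists>z. (f has_real_derivative z) (at y) \<and> 0 \<le> z"
        unfolding f_def
        by (intro exI[of _ "exp y - exp (- y) - 2 * y"]) (auto intro!: derivative_eq_intros)
    qed
    then show ?thesis by (simp add: f_def)
  qed
  show ?thesis
    using *[of x] *[of "- x"] by (cases "x \<ge> 0") (auto simp: add.commute)
qed

text \<open>
  A symmetric second difference quotient, evaluated by l'Hopital's rule; only the derivative of
  \<open>g'\<close> at the single point \<open>0\<close> enters.
\<close>

lemma symmetric_exp_difference_quotient:
  fixes g g' :: "real \<Rightarrow> real"
  assumes "\<delta> > 0" and g: "\<And>s. \<bar>s\<bar> < \<delta> \<Longrightarrow> (g has_real_derivative g' s) (at s)"
    and "g 0 = 0" "g' 0 = 0" and g'': "(g' has_real_derivative V) (at 0)"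
  shows "((\<lambda>s. (exp (g s) + exp (g (- s)) - 2) / s^2) \<longlongrightarrow> V) (at_right 0)"
proof (rule lhopital_right_0[where f' = "\<lambda>s. g' s * exp (g s) - g' (- s) * exp (g (- s))"
      and g' = "\<lambda>s. 2 * s"])
  have near: "eventually (\<lambda>s. s > 0 \<and> s < \<delta>) (at_right 0)"
    using assms(1) by (auto simp: eventually_at_right_field)
  have "isCont g 0" using g[of 0] assms(1) by (auto intro: DERIV_isCont)
  then have g0: "(g \<longlongrightarrow> 0) (at 0)" using \<open>g 0 = 0\<close> by (simp add: isCont_def)
  have neg: "filterlim (\<lambda>s::real. - s) (at 0) (at_right 0)"
    unfolding filterlim_at by (auto intro!: tendsto_eq_intros simp: eventually_at_right_field intro: exI[of _ 1])
  have pos: "filterlim (\<lambda>s::real. s) (at 0) (at_right 0)"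
    unfolding filterlim_at by (auto intro!: tendsto_eq_intros simp: eventually_at_right_field intro: exI[of _ 1])
  have gp: "(g \<longlongrightarrow> 0) (at_right 0)" using filterlim_compose[OF g0 pos] .
  have gn: "((\<lambda>s. g (- s)) \<longlongrightarrow> 0) (at_right 0)" using filterlim_compose[OF g0 neg] .
  have q: "((\<lambda>s. g' s / s) \<longlongrightarrow> V) (at 0)"
    using g'' \<open>g' 0 = 0\<close> by (simp add: has_field_derivative_iff)
  have qp: "((\<lambda>s. g' s / s) \<longlongrightarrow> V) (at_right 0)" using filterlim_compose[OF q pos] .
  have qn: "((\<lambda>s. g' (- s) / - s) \<longlongrightarrow> V) (at_right 0)" using filterlim_compose[OF q neg] .
  show "((\<lambda>s. exp (g s) + exp (g (- s)) - 2) \<longlongrightarrow> 0) (at_right 0)"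
    by (auto intro!: tendsto_eq_intros gp gn)
  show "((\<lambda>s::real. s^2) \<longlongrightarrow> 0) (at_right 0)" by (auto intro!: tendsto_eq_intros)
  show "eventually (\<lambda>s::real. s^2 \<noteq> 0) (at_right 0)" "eventually (\<lambda>s::real. 2 * s \<noteq> 0) (at_right 0)"
    by (auto simp: eventually_at_right_field intro!: exI[of _ 1])
  show "eventually (\<lambda>s. ((\<lambda>s. exp (g s) + exp (g (- s)) - 2) has_real_derivative
      g' s * exp (g s) - g' (- s) * exp (g (- s))) (at s)) (at_right 0)"
    using near
  proof eventually_elim
    case (elim s)
    have "(uminus has_real_derivative - 1) (at s)" by (auto intro!: derivative_eq_intros)
    from DERIV_chain2[OF _ this, of g "g' (- s)"] have "((\<lambda>s. g (- s)) has_real_derivative - g' (- s)) (at s)"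
      using g[of "- s"] elim by simp
    then show ?case using g[of s] elim by (auto intro!: derivative_eq_intros)
  qed
  show "eventually (\<lambda>s::real. ((\<lambda>s. s^2) has_real_derivative 2 * s) (at s)) (at_right 0)"
    by (auto intro!: always_eventually derivative_eq_intros)
  have "((\<lambda>s. (g' s / s * exp (g s) + g' (- s) / - s * exp (g (- s))) / 2) \<longlongrightarrow> (V * exp 0 + V * exp 0) / 2) (at_right 0)"
    by (intro tendsto_intros qp qn gp gn) auto
  also have "(V * exp 0 + V * exp 0) / 2 = V" by simp
  finally show "((\<lambda>s. (g' s * exp (g s) - g' (- s) * exp (g (- s))) / (2 * s)) \<longlongrightarrow> V) (at_right 0)"
    by (rule Lim_transform_eventually) (use near in \<open>eventually_elim, simp add: field_simps\<close>)
qed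

section \<open>Sums of independent identically distributed random variables\<close>

text \<open>
  The law of the sum of \<open>N\<close> independent variables with law \<open>\<nu>\<close>.  Working with this law on the fixed
  space \<open>'a\<close>, instead of with product measures, keeps the number of summands a plain natural number
  and makes inductions on the sample size immediate.
\<close>

primrec iid_sum :: "'a::euclidean_space measure \<Rightarrow> nat \<Rightarrow> 'a measure" where
  "iid_sum \<nu> 0 = return borel 0"
| "iid_sum \<nu> (Suc N) = distr (iid_sum \<nu> N \<Otimes>\<^sub>M \<nu>) borel (\<lambda>(s, x). s + x)"

lemma sets_iid_sum [simp, measurable_cong]: "sets (iid_sum \<nu> N) = sets borel"
  by (cases N) simp_all

lemma space_iid_sum [simp]: "space (iid_sum \<nu> N) = UNIV"
  by (cases N) simp_all

lemma prob_space_iid_sum: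
  assumes "prob_space \<nu>" and [measurable_cong]: "sets \<nu> = sets borel"
  shows "prob_space (iid_sum \<nu> N)"
proof (induction N)
  case 0
  then show ?case by (auto intro: prob_space_return)
next
  case (Suc N)
  interpret \<nu>: prob_space \<nu> by fact
  interpret S: prob_space "iid_sum \<nu> N" by fact
  interpret P: pair_prob_space "iid_sum \<nu> N" \<nu> ..
  show ?case by (simp, rule P.prob_space_distr) measurable
qed

lemma nn_integral_iid_sum_0:
  fixes f :: "'a::euclidean_space \<Rightarrow> ennreal"
  assumes "f \<in> borel_measurable borel"
  shows "(\<integral>\<^sup>+ s. f s \<partial>iid_sum \<nu> 0) = f 0"
  using assms by (simp add: nn_integral_return)

lemma nn_integral_iid_sum_Suc:
  fixes \<nu> :: "'a::euclidean_space measure"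
  assumes "prob_space \<nu>" and [measurable_cong]: "sets \<nu> = sets borel"
    and [measurable]: "f \<in> borel_measurable borel"
  shows "(\<integral>\<^sup>+ s. f s \<partial>iid_sum \<nu> (Suc N)) = (\<integral>\<^sup>+ s. \<integral>\<^sup>+ x. f (s + x) \<partial>\<nu> \<partial>iid_sum \<nu> N)"
proof -
  interpret \<nu>: prob_space \<nu> by fact
  show ?thesis
    by (simp add: nn_integral_distr \<nu>.nn_integral_fst[symmetric] case_prod_beta)
qed

lemma AE_iid_sum_Suc:
  fixes \<nu> :: "'a::euclidean_space measure"
  assumes "prob_space \<nu>" and [measurable_cong]: "sets \<nu> = sets borel"
    and [measurable]: "Measurable.pred borel P"
    and "AE s in iid_sum \<nu> N. AE x in \<nu>. P (s + x)"
  shows "AE s in iid_sum \<nu> (Suc N). P s"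
proof -
  interpret \<nu>: prob_space \<nu> by fact
  interpret S: prob_space "iid_sum \<nu> N" by (rule prob_space_iid_sum[OF assms(1,2)])
  interpret P: pair_prob_space "iid_sum \<nu> N" \<nu> ..
  have "Measurable.pred (iid_sum \<nu> N \<Otimes>\<^sub>M \<nu>) (\<lambda>z. P (fst z + snd z))" by measurable
  then have "AE z in iid_sum \<nu> N \<Otimes>\<^sub>M \<nu>. P (fst z + snd z)"
    using assms(4) by (intro P.AE_pair_measure) (simp_all only: pred_def fst_conv snd_conv)
  then show ?thesis
    unfolding iid_sum.simps by (subst AE_distr_iff) (simp_all add: case_prod_beta)
qed

lemma distr_iid_sum_linear:
  fixes \<nu> :: "'a::euclidean_space measure" and F :: "'a \<Rightarrow> 'b::euclidean_space"
  assumes "prob_space \<nu>" and [measurable_cong]: "sets \<nu> = sets borel" and "linear F"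
  shows "distr (iid_sum \<nu> N) borel F = iid_sum (distr \<nu> borel F) N"
proof -
  interpret \<nu>: prob_space \<nu> by fact
  have [measurable]: "F \<in> borel_measurable borel"
    using assms(3) by (intro borel_measurable_continuous_onI linear_continuous_on linear_conv_bounded_linear[THEN iffD1])
  have \<nu>': "prob_space (distr \<nu> borel F)" by (rule \<nu>.prob_space_distr) simp
  show ?thesis
  proof (induction N)
    case 0
    then show ?case using linear_0[OF assms(3)] by (simp add: distr_return)
  next
    case (Suc N)
    show ?case
    proof (rule measure_eqI)
      fix A assume "A \<in> sets (distr (iid_sum \<nu> (Suc N)) borel F)"
      then have [measurable]: "A \<in> sets borel" by simp
      have "emeasure (distr (iid_sum \<nu> (Suc N)) borel F) A
          = (\<integral>\<^sup>+ s. indicator A (F s) \<partial>iid_sum \<nu> (Suc N))"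
        by (subst nn_integral_indicator[symmetric], simp, subst nn_integral_distr) auto
      also have "\<dots> = (\<integral>\<^sup>+ s. \<integral>\<^sup>+ x. indicator A (F s + F x) \<partial>\<nu> \<partial>iid_sum \<nu> N)"
        by (subst nn_integral_iid_sum_Suc[OF assms(1,2)]) (simp_all add: linear_add[OF assms(3)])
      also have "\<dots> = (\<integral>\<^sup>+ s. \<integral>\<^sup>+ x. indicator A (s + x) \<partial>distr \<nu> borel F \<partial>distr (iid_sum \<nu> N) borel F)"
        by (simp add: nn_integral_distr)
      also have "\<dots> = (\<integral>\<^sup>+ s. indicator A s \<partial>iid_sum (distr \<nu> borel F) (Suc N))"
        unfolding Suc by (subst nn_integral_iid_sum_Suc[OF \<nu>']) simp_all
      finally show "emeasure (distr (iid_sum \<nu> (Suc N)) borel F) A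
          = emeasure (iid_sum (distr \<nu> borel F) (Suc N)) A"
        by (subst (asm) nn_integral_indicator) auto
    qed simp
  qed
qed

lemma (in prob_space) distr_sum_indep_identical:
  fixes G :: "nat \<Rightarrow> 'a \<Rightarrow> 'b::euclidean_space"
  assumes ind: "indep_vars (\<lambda>_. borel) G {1..N}"
    and id: "\<And>k. k \<in> {1..N} \<Longrightarrow> distr M borel (G k) = \<nu>"
  shows "distr M borel (\<lambda>\<omega>. \<Sum>k = 1..N. G k \<omega>) = iid_sum \<nu> N"
  using assms
proof (induction N)
  case 0
  have "distr M borel (\<lambda>_. 0::'b) = return borel 0"
    by (rule measure_eqI) (auto simp: emeasure_distr emeasure_space_1 split: split_indicator)
  then show ?case by simp
next
  case (Suc N)
  have rv [measurable]: "random_variable borel (G k)" if "k \<in> {1..Suc N}" for k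
    using Suc.prems(1) that by (auto simp: indep_vars_def)
  have ind: "indep_vars (\<lambda>_. borel) G (insert (Suc N) {1..N})"
    using Suc.prems(1) by (simp add: atLeastAtMostSuc_conv)
  have "indep_var
    borel ((\<lambda>f. \<Sum>i\<in>{1..N}. f i) \<circ> (\<lambda>\<omega>. restrict (\<lambda>i. G i \<omega>) {1..N}))
    borel ((\<lambda>f. f (Suc N)) \<circ> (\<lambda>\<omega>. restrict (\<lambda>i. G i \<omega>) {Suc N}))"
    by (intro indep_var_compose[OF indep_var_restrict[OF ind]]) auto
  also have "(\<lambda>f. \<Sum>i\<in>{1..N}. f i) \<circ> (\<lambda>\<omega>. restrict (\<lambda>i. G i \<omega>) {1..N}) = (\<lambda>\<omega>. \<Sum>k=1..N. G k \<omega>)"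
    by (auto cong: rev_conj_cong)
  also have "(\<lambda>f. f (Suc N)) \<circ> (\<lambda>\<omega>. restrict (\<lambda>i. G i \<omega>) {Suc N}) = G (Suc N)"
    by auto
  finally have iv: "indep_var borel (\<lambda>\<omega>. \<Sum>k=1..N. G k \<omega>) borel (G (Suc N))" .
  have [measurable]: "random_variable borel (\<lambda>\<omega>. \<Sum>k=1..N. G k \<omega>)"
    by (rule borel_measurable_sum) (auto intro: rv)
  have [measurable]: "random_variable borel (G (Suc N))" by (rule rv) simp
  have "distr M borel (\<lambda>\<omega>. \<Sum>k=1..N. G k \<omega>) = iid_sum \<nu> N"
    using Suc.prems by (intro Suc.IH indep_vars_subset[OF Suc.prems(1)]) auto
  then have "iid_sum \<nu> N \<Otimes>\<^sub>M \<nu> = distr M (borel \<Otimes>\<^sub>M borel) (\<lambda>\<omega>. (\<Sum>k=1..N. G k \<omega>, G (Suc N) \<omega>))"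
    using iv Suc.prems(2)[of "Suc N"] by (simp add: indep_var_distribution_eq)
  then show ?case by (simp add: distr_distr comp_def)
qed

section \<open>Mellin transforms of chi-square distributions\<close>

abbreviation std_normal :: "real measure" where
  "std_normal \<equiv> density lborel (\<lambda>x. ennreal (std_normal_density x))"

lemma prob_space_std_normal: "prob_space std_normal"
  using prob_space_normal_density[of 1 0] by simp

definition chi_square :: "nat \<Rightarrow> real measure" where
  "chi_square N = iid_sum (distr std_normal borel (\<lambda>x. x^2)) N"

lemma sets_chi_square [simp, measurable_cong]: "sets (chi_square N) = sets borel"
  by (simp add: chi_square_def)

lemma prob_space_square: "prob_space (distr std_normal borel (\<lambda>x::real. x^2))"
  by (rule prob_space.prob_space_distr[OF prob_space_std_normal]) simp

lemma prob_space_chi_square: "prob_space (chi_square N)"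
  unfolding chi_square_def by (rule prob_space_iid_sum[OF prob_space_square]) simp

lemma AE_std_normal_nonzero: "AE x in std_normal. x \<noteq> 0"
  by (subst AE_density, simp) (use AE_lborel_singleton[of "0::real"] in \<open>eventually_elim, simp\<close>)

lemma AE_sum_squares_nonneg:
  assumes "prob_space \<rho>" and [measurable_cong]: "sets \<rho> = sets (borel::real measure)"
  shows "AE r in iid_sum (distr \<rho> borel (\<lambda>x. x^2)) N. 0 \<le> r"
proof (induction N)
  case 0
  show ?case unfolding iid_sum.simps by (subst AE_return) auto
next
  case (Suc N)
  have \<nu>: "prob_space (distr \<rho> borel (\<lambda>x. x^2))"
    by (rule prob_space.prob_space_distr[OF assms(1)]) simp
  show ?case
    by (rule AE_iid_sum_Suc[OF \<nu>], simp, measurable)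
      (use Suc in \<open>eventually_elim, simp add: AE_distr_iff\<close>)
qed

lemma AE_sum_squares_pos:
  assumes "prob_space \<rho>" and [measurable_cong]: "sets \<rho> = sets (borel::real measure)"
    and "AE x in \<rho>. x \<noteq> 0"
  shows "AE r in iid_sum (distr \<rho> borel (\<lambda>x. x^2)) (Suc N). 0 < r"
proof -
  have \<nu>: "prob_space (distr \<rho> borel (\<lambda>x. x^2))"
    by (rule prob_space.prob_space_distr[OF assms(1)]) simp
  have "AE x in distr \<rho> borel (\<lambda>x. x^2). 0 < x"
    using assms(3) by (subst AE_distr_iff) auto
  then have "AE x in distr \<rho> borel (\<lambda>x. x^2). 0 < r + x" if "0 \<le> r" for r
    by eventually_elim (use that in simp)
  then show ?thesis
    by (intro AE_iid_sum_Suc[OF \<nu>], simp, measurable)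
      (use AE_sum_squares_nonneg[OF assms(1,2)] in eventually_elim, simp)
qed

lemma AE_chi_square_nonneg: "AE r in chi_square N. 0 \<le> r"
  unfolding chi_square_def by (rule AE_sum_squares_nonneg[OF prob_space_std_normal]) simp

lemma AE_chi_square_pos: "N > 0 \<Longrightarrow> AE r in chi_square N. 0 < r"
  unfolding chi_square_def
  using AE_sum_squares_pos[OF prob_space_std_normal _ AE_std_normal_nonzero, of "N - 1"]
  by (simp only: Suc_pred' [symmetric]) simp

lemma nn_integral_chi_square_Suc:
  assumes [measurable]: "f \<in> borel_measurable borel"
  shows "(\<integral>\<^sup>+ r. f r \<partial>chi_square (Suc N)) = (\<integral>\<^sup>+ r. \<integral>\<^sup>+ x. f (r + x^2) \<partial>std_normal \<partial>chi_square N)"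
  unfolding chi_square_def
  by (subst nn_integral_iid_sum_Suc[OF prob_space_square]) (simp_all add: nn_integral_distr)

text \<open>
  Multiplying the standard normal density by \<open>exp (- l x\<^sup>2)\<close> gives a multiple of another centred normal
  density, so the moments of the tilted density are known.
\<close>

lemma std_normal_tilt:
  fixes l :: real
  assumes "l \<ge> 0"
  defines "\<sigma> \<equiv> 1 / sqrt (1 + 2 * l)"
  shows "std_normal_density x * exp (- l * x^2) = \<sigma> * normal_density 0 \<sigma> x"
proof -
  have s: "\<sigma>^2 = 1 / (1 + 2 * l)" and "\<sigma> > 0"
    using assms(1) by (simp_all add: \<sigma>_def power_divide)
  have "normal_density 0 \<sigma> x = 1 / (sqrt (2 * pi) * \<sigma>) * exp (- (x^2) / (2 * \<sigma>^2))"
    using \<open>\<sigma> > 0\<close> by (simp add: normal_density_def real_sqrt_mult)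
  also have "- (x^2) / (2 * \<sigma>^2) = - (x^2) / 2 + - l * x^2"
    using assms(1) by (simp add: s field_simps)
  finally have "normal_density 0 \<sigma> x
      = 1 / (sqrt (2 * pi) * \<sigma>) * (exp (- (x^2) / 2) * exp (- l * x^2))"
    by (simp only: exp_add)
  then show ?thesis
    using \<open>\<sigma> > 0\<close> by (simp add: std_normal_density_def)
qed

lemma laplace_square_std_normal:
  fixes l :: real
  assumes "l \<ge> 0"
  shows "(\<integral>\<^sup>+ x. ennreal (exp (- l * x^2)) \<partial>std_normal) = ennreal ((1 + 2 * l) powr (- 1 / 2))"
    and "(\<integral>\<^sup>+ x. ennreal (x^2 * exp (- l * x^2)) \<partial>std_normal) = ennreal ((1 + 2 * l) powr (- 3 / 2))"
proof -
  define \<sigma> where "\<sigma> = 1 / sqrt (1 + 2 * l)"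
  have \<sigma>: "\<sigma> > 0" using assms by (simp add: \<sigma>_def)
  have pw: "\<sigma> = (1 + 2 * l) powr (- 1 / 2)"
    using assms by (simp add: \<sigma>_def powr_half_sqrt[symmetric] powr_minus_divide)
  have tilt: "std_normal_density x * exp (- l * x^2) = \<sigma> * normal_density 0 \<sigma> x" for x
    unfolding \<sigma>_def by (rule std_normal_tilt[OF assms])
  have "(\<integral>\<^sup>+ x. ennreal (exp (- l * x^2)) \<partial>std_normal)
      = (\<integral>\<^sup>+ x. ennreal (\<sigma> * normal_density 0 \<sigma> x) \<partial>lborel)"
    by (subst nn_integral_density) (simp_all add: ennreal_mult'[symmetric] tilt[symmetric])
  also have "\<dots> = ennreal (\<integral> x. \<sigma> * normal_density 0 \<sigma> x \<partial>lborel)"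
    using \<sigma> by (intro nn_integral_eq_integral) (auto intro!: integrable_mult_right)
  finally show "(\<integral>\<^sup>+ x. ennreal (exp (- l * x^2)) \<partial>std_normal) = ennreal ((1 + 2 * l) powr (- 1 / 2))"
    using \<sigma> pw by simp
  have "(\<integral>\<^sup>+ x. ennreal (x^2 * exp (- l * x^2)) \<partial>std_normal)
      = (\<integral>\<^sup>+ x. ennreal (\<sigma> * (normal_density 0 \<sigma> x * (x - 0)^(2 * 1))) \<partial>lborel)"
    by (subst nn_integral_density) 
       (simp_all add: ennreal_mult'[symmetric] mult.assoc[symmetric] tilt[symmetric], simp add: mult_ac)
  also have "\<dots> = ennreal (\<integral> x. \<sigma> * (normal_density 0 \<sigma> x * (x - 0)^(2 * 1)) \<partial>lborel)"
    using \<sigma> by (intro nn_integral_eq_integral integrable_mult_right integrable_normal_moment) auto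
  also have "(\<integral> x. \<sigma> * (normal_density 0 \<sigma> x * (x - 0)^(2 * 1)) \<partial>lborel) = \<sigma> * \<sigma>^2"
    using integral_normal_moment_even[OF \<sigma>, of 0 1] \<sigma> by simp
  also have "\<sigma> * \<sigma>^2 = (1 + 2 * l) powr (- 3 / 2)"
    unfolding pw power2_eq_square powr_add[symmetric] by simp
  finally show "(\<integral>\<^sup>+ x. ennreal (x^2 * exp (- l * x^2)) \<partial>std_normal) = ennreal ((1 + 2 * l) powr (- 3 / 2))" .
qed

lemma laplace_chi_square:
  fixes l :: real
  assumes "l \<ge> 0"
  shows "(\<integral>\<^sup>+ r. ennreal (exp (- l * r)) \<partial>chi_square N) = ennreal ((1 + 2 * l) powr (- real N / 2))"
proof (induction N)
  case 0
  then show ?case using assms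
    unfolding chi_square_def by (subst nn_integral_iid_sum_0) auto
next
  case (Suc N)
  have "(\<integral>\<^sup>+ r. ennreal (exp (- l * r)) \<partial>chi_square (Suc N))
      = (\<integral>\<^sup>+ r. \<integral>\<^sup>+ x. ennreal (exp (- l * r)) * ennreal (exp (- l * x^2)) \<partial>std_normal \<partial>chi_square N)"
    by (subst nn_integral_chi_square_Suc)
      (auto simp: ennreal_mult'[symmetric] exp_add[symmetric] algebra_simps)
  also have "\<dots> = ennreal ((1 + 2 * l) powr (- real N / 2)) * ennreal ((1 + 2 * l) powr (- 1 / 2))"
    by (subst nn_integral_cmult) (auto simp: laplace_square_std_normal[OF assms, simplified] nn_integral_multc Suc[simplified])
  also have "\<dots> = ennreal ((1 + 2 * l) powr (- real (Suc N) / 2))"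
    by (simp add: ennreal_mult'[symmetric] powr_add[symmetric] field_simps)
  finally show ?case .
qed

text \<open>
  Up to the sign, the derivative in \<open>l\<close> of the Laplace transform; obtained by a recursion over the summands
  rather than by differentiation under the integral.
\<close>

lemma laplace_derivative_chi_square:
  fixes l :: real
  assumes "l \<ge> 0"
  shows "(\<integral>\<^sup>+ r. ennreal (r * exp (- l * r)) \<partial>chi_square N)
    = ennreal (real N * (1 + 2 * l) powr (- real N / 2 - 1))"
proof (induction N)
  case 0
  then show ?case
    unfolding chi_square_def by (subst nn_integral_iid_sum_0) auto
next
  case (Suc N)
  have "(\<integral>\<^sup>+ r. ennreal (r * exp (- l * r)) \<partial>chi_square (Suc N))
      = (\<integral>\<^sup>+ r. \<integral>\<^sup>+ x. ennreal ((r + x^2) * exp (- l * (r + x^2))) \<partial>std_normal \<partial>chi_square N)"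
    by (subst nn_integral_chi_square_Suc) auto
  also have "\<dots> = (\<integral>\<^sup>+ r. \<integral>\<^sup>+ x. ennreal (r * exp (- l * r)) * ennreal (exp (- l * x^2))
        + ennreal (exp (- l * r)) * ennreal (x^2 * exp (- l * x^2)) \<partial>std_normal \<partial>chi_square N)"
    using AE_chi_square_nonneg[of N]
    by (intro nn_integral_cong_AE, eventually_elim, intro nn_integral_cong)
       (auto simp: ennreal_mult'[symmetric] ennreal_plus[symmetric] exp_add[symmetric] algebra_simps
          simp del: ennreal_plus)
  also have "\<dots> = (\<integral>\<^sup>+ r. ennreal (r * exp (- l * r)) * ennreal ((1 + 2 * l) powr (- 1 / 2))
        + ennreal (exp (- l * r)) * ennreal ((1 + 2 * l) powr (- 3 / 2)) \<partial>chi_square N)"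
    by (simp add: nn_integral_add nn_integral_cmult laplace_square_std_normal[OF assms, simplified])
  also have "\<dots> = ennreal (real N * (1 + 2 * l) powr (- real N / 2 - 1)) * ennreal ((1 + 2 * l) powr (- 1 / 2))
        + ennreal ((1 + 2 * l) powr (- real N / 2)) * ennreal ((1 + 2 * l) powr (- 3 / 2))"
    by (simp add: nn_integral_add nn_integral_multc Suc[simplified] laplace_chi_square[OF assms, simplified])
  also have "\<dots> = ennreal (real N * ((1 + 2 * l) powr (- real N / 2 - 1) * (1 + 2 * l) powr (- 1 / 2))
        + (1 + 2 * l) powr (- real N / 2) * (1 + 2 * l) powr (- 3 / 2))"
    by (simp add: ennreal_mult'[symmetric] ennreal_plus[symmetric] mult.assoc del: ennreal_plus)
  also have "(1 + 2 * l) powr (- real N / 2 - 1) * (1 + 2 * l) powr (- 1 / 2)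
      = (1 + 2 * l) powr (- real (Suc N) / 2 - 1)"
    unfolding powr_add[symmetric] by (rule arg_cong[where f = "(powr) _"]) (simp add: field_simps)
  also have "(1 + 2 * l) powr (- real N / 2) * (1 + 2 * l) powr (- 3 / 2)
      = (1 + 2 * l) powr (- real (Suc N) / 2 - 1)"
    unfolding powr_add[symmetric] by (rule arg_cong[where f = "(powr) _"]) (simp add: field_simps)
  finally show ?case by (simp add: algebra_simps)
qed

lemma Gamma_nn_integral_scaled:
  fixes s c :: real
  assumes "s > 0" "c > 0"
  shows "(\<integral>\<^sup>+ t. ennreal (indicator {0<..} t * t powr (s - 1) * exp (- c * t)) \<partial>lborel)
    = ennreal (Gamma s * c powr (- s))"
proof -
  have "ennreal (Gamma s) = (\<integral>\<^sup>+ t. ennreal (indicator {0..} t * t powr (s - 1) / exp t) \<partial>lborel)"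
    by (rule Gamma_conv_nn_integral_real[OF assms(1)])
  also have "\<dots> = (\<integral>\<^sup>+ t. ennreal (indicator {0<..} t * t powr (s - 1) * exp (- t)) \<partial>lborel)"
    by (intro nn_integral_cong) (auto simp: indicator_def exp_minus divide_inverse)
  also have "\<dots> = ennreal \<bar>c\<bar> * (\<integral>\<^sup>+ t. ennreal (indicator {0<..} (0 + c * t) * (0 + c * t) powr (s - 1) * exp (- (0 + c * t))) \<partial>lborel)"
    using assms(2) by (subst nn_integral_real_affine[of _ c 0]) auto
  also have "\<dots> = (\<integral>\<^sup>+ t. ennreal c * ennreal (indicator {0<..} (0 + c * t) * (0 + c * t) powr (s - 1) * exp (- (0 + c * t))) \<partial>lborel)"
    using assms(2) by (subst nn_integral_cmult) auto
  also have "\<dots> = (\<integral>\<^sup>+ t. ennreal (c powr s) * ennreal (indicator {0<..} t * t powr (s - 1) * exp (- c * t)) \<partial>lborel)"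
  proof (intro nn_integral_cong)
    fix t :: real
    show "ennreal c * ennreal (indicator {0<..} (0 + c * t) * (0 + c * t) powr (s - 1) * exp (- (0 + c * t)))
      = ennreal (c powr s) * ennreal (indicator {0<..} t * t powr (s - 1) * exp (- c * t))"
      using assms(2) by (auto simp: ennreal_mult'[symmetric] indicator_def zero_less_mult_iff powr_mult powr_diff)
  qed
  also have "\<dots> = ennreal (c powr s) * (\<integral>\<^sup>+ t. ennreal (indicator {0<..} t * t powr (s - 1) * exp (- c * t)) \<partial>lborel)"
    by (rule nn_integral_cmult) simp
  finally have "ennreal (c powr (- s)) * ennreal (Gamma s) = ennreal (c powr (- s)) * ennreal (c powr s) *
    (\<integral>\<^sup>+ t. ennreal (indicator {0<..} t * t powr (s - 1) * exp (- c * t)) \<partial>lborel)"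
    by (simp add: mult.assoc)
  then show ?thesis
    using assms by (simp add: ennreal_mult'[symmetric] powr_add[symmetric] mult.commute)
qed

text \<open>
  Writing \<open>(1 + 2 l) powr (- b)\<close> as a Gamma integral in \<open>t\<close> and exchanging the integrals leaves two
  Gamma integrals.
\<close>

lemma beta_prime_nn_integral:
  fixes u b :: real
  assumes "0 < u" "u < b"
  shows "(\<integral>\<^sup>+ l. ennreal (indicator {0<..} l * l powr (u - 1) * (1 + 2 * l) powr (- b)) \<partial>lborel)
    = ennreal (2 powr (- u) * Gamma u * Gamma (b - u) / Gamma b)"
proof -
  have Gb: "Gamma b > 0" using assms by simp
  have "ennreal (Gamma b) * (\<integral>\<^sup>+ l. ennreal (indicator {0<..} l * l powr (u - 1) * (1 + 2 * l) powr (- b)) \<partial>lborel)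
      = (\<integral>\<^sup>+ l. ennreal (indicator {0<..} l * l powr (u - 1)) * ennreal (Gamma b * (1 + 2 * l) powr (- b)) \<partial>lborel)"
    using Gb by (subst nn_integral_cmult[symmetric]) (auto simp: ennreal_mult'[symmetric] mult_ac)
  also have "\<dots> = (\<integral>\<^sup>+ l. \<integral>\<^sup>+ t. ennreal (indicator {0<..} l * l powr (u - 1)) *
      ennreal (indicator {0<..} t * t powr (b - 1) * exp (- (1 + 2 * l) * t)) \<partial>lborel \<partial>lborel)"
  proof (intro nn_integral_cong)
    fix l :: real
    show "ennreal (indicator {0<..} l * l powr (u - 1)) * ennreal (Gamma b * (1 + 2 * l) powr (- b))
      = (\<integral>\<^sup>+ t. ennreal (indicator {0<..} l * l powr (u - 1)) *
      ennreal (indicator {0<..} t * t powr (b - 1) * exp (- (1 + 2 * l) * t)) \<partial>lborel)"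
    proof (cases "l > 0")
      case True
      then have "ennreal (Gamma b * (1 + 2 * l) powr (- b))
        = (\<integral>\<^sup>+ t. ennreal (indicator {0<..} t * t powr (b - 1) * exp (- (1 + 2 * l) * t)) \<partial>lborel)"
        using assms by (subst Gamma_nn_integral_scaled) auto
      then show ?thesis by (subst nn_integral_cmult) auto
    qed simp
  qed
  also have "\<dots> = (\<integral>\<^sup>+ t. \<integral>\<^sup>+ l. ennreal (indicator {0<..} l * l powr (u - 1)) *
      ennreal (indicator {0<..} t * t powr (b - 1) * exp (- (1 + 2 * l) * t)) \<partial>lborel \<partial>lborel)"
    by (rule lborel_pair.Fubini') simp
  also have "\<dots> = (\<integral>\<^sup>+ t. ennreal (Gamma u * 2 powr (- u)) *
      ennreal (indicator {0<..} t * t powr (b - u - 1) * exp (- 1 * t)) \<partial>lborel)"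
  proof (intro nn_integral_cong)
    fix t :: real
    show "(\<integral>\<^sup>+ l. ennreal (indicator {0<..} l * l powr (u - 1)) *
      ennreal (indicator {0<..} t * t powr (b - 1) * exp (- (1 + 2 * l) * t)) \<partial>lborel)
      = ennreal (Gamma u * 2 powr (- u)) * ennreal (indicator {0<..} t * t powr (b - u - 1) * exp (- 1 * t))"
    proof (cases "t > 0")
      case True
      have "(\<integral>\<^sup>+ l. ennreal (indicator {0<..} l * l powr (u - 1)) *
          ennreal (indicator {0<..} t * t powr (b - 1) * exp (- (1 + 2 * l) * t)) \<partial>lborel)
        = (\<integral>\<^sup>+ l. ennreal (t powr (b - 1) * exp (- t)) *
            ennreal (indicator {0<..} l * l powr (u - 1) * exp (- (2 * t) * l)) \<partial>lborel)"
        using True by (intro nn_integral_cong)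
          (auto simp: ennreal_mult'[symmetric] indicator_def exp_add[symmetric] algebra_simps)
      also have "\<dots> = ennreal (t powr (b - 1) * exp (- t)) * ennreal (Gamma u * (2 * t) powr (- u))"
        using True assms by (subst nn_integral_cmult, simp, subst Gamma_nn_integral_scaled) simp_all
      also have "\<dots> = ennreal (Gamma u * 2 powr (- u)) * ennreal (t powr (b - u - 1) * exp (- 1 * t))"
        using True assms by (simp add: ennreal_mult'[symmetric] powr_mult powr_diff powr_minus powr_add field_simps)
      finally show ?thesis using True by simp
    qed simp
  qed
  also have "\<dots> = ennreal (Gamma u * 2 powr (- u)) * ennreal (Gamma (b - u))"
    using assms by (subst nn_integral_cmult) (auto simp: Gamma_nn_integral_scaled[where c = 1, simplified])
  finally have "ennreal (1 / Gamma b) * ennreal (Gamma b) *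
     (\<integral>\<^sup>+ l. ennreal (indicator {0<..} l * l powr (u - 1) * (1 + 2 * l) powr (- b)) \<partial>lborel)
    = ennreal (1 / Gamma b) * (ennreal (Gamma u * 2 powr (- u)) * ennreal (Gamma (b - u)))"
    by (simp add: mult.assoc)
  then show ?thesis
    using Gb assms by (simp add: ennreal_mult'[symmetric] mult_ac)
qed


text \<open>
  The power \<open>d\<^sup>s\<close>, with the value \<open>\<infinity>\<close> for \<open>d \<le> 0\<close>.  A finite integral of the kernel thus shows that
  \<open>d\<close> is positive almost everywhere, which rules out the conventional value of the logarithm at \<open>0\<close>.
\<close>

definition mellin_kernel :: "real \<Rightarrow> real \<Rightarrow> ennreal" where
  "mellin_kernel s d = (if d > 0 then ennreal (d powr s) else \<infinity>)"

lemma borel_measurable_mellin_kernel [measurable]: "mellin_kernel s \<in> borel_measurable borel"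
  unfolding mellin_kernel_def[abs_def] by measurable

lemma mellin_kernel_mult:
  assumes "r \<ge> 0"
  shows "mellin_kernel s (r * d) = mellin_kernel s r * mellin_kernel s d"
proof (cases "r > 0 \<and> d > 0")
  case True
  then show ?thesis by (simp add: mellin_kernel_def powr_mult ennreal_mult')
next
  case False
  then show ?thesis
    using assms by (auto simp: mellin_kernel_def zero_less_mult_iff ennreal_mult_top ennreal_top_mult)
qed

text \<open>
  The power \<open>r powr (- u)\<close> is a mixture of exponentials \<open>exp (- l r)\<close>, by the Gamma integral, so the
  Laplace transform determines the negative moments.
\<close>

lemma mellin_chi_square_negative:
  assumes "0 < u" "u < real N / 2"
  shows "(\<integral>\<^sup>+ r. mellin_kernel (- u) r \<partial>chi_square N)
    = ennreal (2 powr (- u) * Gamma (real N / 2 - u) / Gamma (real N / 2))"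
proof -
  interpret prob_space "chi_square N" by (rule prob_space_chi_square)
  have N: "N > 0" using assms by (cases N) auto
  have Gu: "Gamma u > 0" using assms by simp
  have "ennreal (Gamma u) * (\<integral>\<^sup>+ r. mellin_kernel (- u) r \<partial>chi_square N)
      = (\<integral>\<^sup>+ r. ennreal (Gamma u) * mellin_kernel (- u) r \<partial>chi_square N)"
    by (rule nn_integral_cmult[symmetric]) simp
  also have "\<dots> = (\<integral>\<^sup>+ r. \<integral>\<^sup>+ l. ennreal (indicator {0<..} l * l powr (u - 1)) * ennreal (exp (- l * r)) \<partial>lborel \<partial>chi_square N)"
  proof (rule nn_integral_cong_AE)
    show "AE r in chi_square N. ennreal (Gamma u) * mellin_kernel (- u) r
      = (\<integral>\<^sup>+ l. ennreal (indicator {0<..} l * l powr (u - 1)) * ennreal (exp (- l * r)) \<partial>lborel)"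
      using AE_chi_square_pos[OF N]
    proof eventually_elim
      case (elim r)
      then show ?case
        using Gamma_nn_integral_scaled[OF assms(1) elim] Gu
        by (simp add: mellin_kernel_def ennreal_mult'[symmetric] mult.commute)
    qed
  qed
  also have "\<dots> = (\<integral>\<^sup>+ l. \<integral>\<^sup>+ r. ennreal (indicator {0<..} l * l powr (u - 1)) * ennreal (exp (- l * r)) \<partial>chi_square N \<partial>lborel)"
    by (rule pair_sigma_finite.Fubini'[symmetric])
      (auto intro!: pair_sigma_finite.intro sigma_finite_measure_axioms sigma_finite_lborel)
  also have "\<dots> = (\<integral>\<^sup>+ l. ennreal (indicator {0<..} l * l powr (u - 1) * (1 + 2 * l) powr (- (real N / 2))) \<partial>lborel)"
  proof (intro nn_integral_cong)
    fix l :: real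
    show "(\<integral>\<^sup>+ r. ennreal (indicator {0<..} l * l powr (u - 1)) * ennreal (exp (- l * r)) \<partial>chi_square N)
      = ennreal (indicator {0<..} l * l powr (u - 1) * (1 + 2 * l) powr (- (real N / 2)))"
      using laplace_chi_square[of l N]
      by (subst nn_integral_cmult, simp) (cases "l > 0"; simp add: ennreal_mult'[symmetric])
  qed
  also have "\<dots> = ennreal (2 powr (- u) * Gamma u * Gamma (real N / 2 - u) / Gamma (real N / 2))"
    by (rule beta_prime_nn_integral[OF assms])
  finally have "ennreal (1 / Gamma u) * ennreal (Gamma u) * (\<integral>\<^sup>+ r. mellin_kernel (- u) r \<partial>chi_square N)
    = ennreal (1 / Gamma u) * ennreal (2 powr (- u) * Gamma u * Gamma (real N / 2 - u) / Gamma (real N / 2))"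
    by (simp add: mult.assoc)
  then show ?thesis
    using Gu assms by (simp add: ennreal_mult'[symmetric])
qed

text \<open>
  Positive moments reduce to the same mixture through \<open>r powr (1 - u) = r * r powr (- u)\<close>.
\<close>

lemma mellin_chi_square_positive:
  assumes "0 < u" "u < 1" "N > 0"
  shows "(\<integral>\<^sup>+ r. mellin_kernel (1 - u) r \<partial>chi_square N)
    = ennreal (2 powr (1 - u) * Gamma (real N / 2 + (1 - u)) / Gamma (real N / 2))"
proof -
  interpret prob_space "chi_square N" by (rule prob_space_chi_square)
  define b where "b = real N / 2 + 1"
  have Gu: "Gamma u > 0" using assms by simp
  have "ennreal (Gamma u) * (\<integral>\<^sup>+ r. mellin_kernel (1 - u) r \<partial>chi_square N)
      = (\<integral>\<^sup>+ r. ennreal (Gamma u) * mellin_kernel (1 - u) r \<partial>chi_square N)"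
    by (rule nn_integral_cmult[symmetric]) simp
  also have "\<dots> = (\<integral>\<^sup>+ r. \<integral>\<^sup>+ l. ennreal (indicator {0<..} l * l powr (u - 1)) * ennreal (r * exp (- l * r)) \<partial>lborel \<partial>chi_square N)"
  proof (rule nn_integral_cong_AE)
    show "AE r in chi_square N. ennreal (Gamma u) * mellin_kernel (1 - u) r
      = (\<integral>\<^sup>+ l. ennreal (indicator {0<..} l * l powr (u - 1)) * ennreal (r * exp (- l * r)) \<partial>lborel)"
      using AE_chi_square_pos[OF assms(3)]
    proof eventually_elim
      case (elim r)
      have "(\<integral>\<^sup>+ l. ennreal (indicator {0<..} l * l powr (u - 1)) * ennreal (r * exp (- l * r)) \<partial>lborel)
        = (\<integral>\<^sup>+ l. ennreal r * ennreal (indicator {0<..} l * l powr (u - 1) * exp (- r * l)) \<partial>lborel)"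
        using elim by (intro nn_integral_cong) (auto simp: ennreal_mult'[symmetric] indicator_def mult_ac)
      also have "\<dots> = ennreal r * ennreal (Gamma u * r powr (- u))"
        by (subst nn_integral_cmult, simp, subst Gamma_nn_integral_scaled[OF assms(1) elim]) simp
      finally show ?case
        using elim Gu by (simp add: mellin_kernel_def ennreal_mult'[symmetric] powr_diff powr_minus field_simps)
    qed
  qed
  also have "\<dots> = (\<integral>\<^sup>+ l. \<integral>\<^sup>+ r. ennreal (indicator {0<..} l * l powr (u - 1)) * ennreal (r * exp (- l * r)) \<partial>chi_square N \<partial>lborel)"
    by (rule pair_sigma_finite.Fubini'[symmetric])
      (auto intro!: pair_sigma_finite.intro sigma_finite_measure_axioms sigma_finite_lborel)
  also have "\<dots> = (\<integral>\<^sup>+ l. ennreal (real N) * ennreal (indicator {0<..} l * l powr (u - 1) * (1 + 2 * l) powr (- b)) \<partial>lborel)"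
  proof (intro nn_integral_cong)
    fix l :: real
    have "- b = - real N / 2 - 1" by (simp add: b_def)
    then show "(\<integral>\<^sup>+ r. ennreal (indicator {0<..} l * l powr (u - 1)) * ennreal (r * exp (- l * r)) \<partial>chi_square N)
      = ennreal (real N) * ennreal (indicator {0<..} l * l powr (u - 1) * (1 + 2 * l) powr (- b))"
      using laplace_derivative_chi_square[of l N]
      by (subst nn_integral_cmult, simp) (cases "l > 0"; simp add: ennreal_mult'[symmetric] mult_ac)
  qed
  also have "\<dots> = ennreal (real N) * ennreal (2 powr (- u) * Gamma u * Gamma (b - u) / Gamma b)"
    using assms by (subst nn_integral_cmult, simp, subst beta_prime_nn_integral) (auto simp: b_def)
  finally have "ennreal (1 / Gamma u) * ennreal (Gamma u) * (\<integral>\<^sup>+ r. mellin_kernel (1 - u) r \<partial>chi_square N)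
    = ennreal (1 / Gamma u) * (ennreal (real N) * ennreal (2 powr (- u) * Gamma u * Gamma (b - u) / Gamma b))"
    by (simp add: mult.assoc)
  then have "(\<integral>\<^sup>+ r. mellin_kernel (1 - u) r \<partial>chi_square N)
    = ennreal (real N * 2 powr (- u) * Gamma (b - u) / Gamma b)"
    using Gu assms by (simp add: ennreal_mult'[symmetric] mult_ac)
  also have "Gamma b = real N / 2 * Gamma (real N / 2)"
    unfolding b_def using assms by (intro Gamma_plus1) (auto elim!: nonpos_Ints_cases)
  also have "real N * 2 powr (- u) * Gamma (b - u) / (real N / 2 * Gamma (real N / 2))
    = 2 powr (1 - u) * Gamma (b - u) / Gamma (real N / 2)"
    using assms by (simp add: powr_diff powr_minus field_simps)
  also have "b - u = real N / 2 + (1 - u)" by (simp add: b_def)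
  finally show ?thesis .
qed

lemma mellin_chi_square:
  assumes "0 < \<bar>s\<bar>" "\<bar>s\<bar> < 1 / 2" "N > 0"
  shows "(\<integral>\<^sup>+ r. mellin_kernel s r \<partial>chi_square N)
    = ennreal (exp (s * ln 2 + (ln_Gamma (real N / 2 + s) - ln_Gamma (real N / 2))))"
proof -
  have N: "real N / 2 \<ge> 1 / 2" using assms(3) by simp
  then have pos: "real N / 2 + s > 0" "real N / 2 > 0" using assms(2) by linarith+
  have "(\<integral>\<^sup>+ r. mellin_kernel s r \<partial>chi_square N)
    = ennreal (2 powr s * Gamma (real N / 2 + s) / Gamma (real N / 2))"
  proof (cases "s > 0")
    case True
    then show ?thesis using mellin_chi_square_positive[of "1 - s" N] assms by simp
  next
    case False
    then show ?thesis using mellin_chi_square_negative[of "- s" N] assms N by simp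
  qed
  also have "2 powr s * Gamma (real N / 2 + s) / Gamma (real N / 2)
    = exp (s * ln 2 + (ln_Gamma (real N / 2 + s) - ln_Gamma (real N / 2)))"
    using pos by (simp add: Gamma_real_pos_exp powr_def exp_add exp_diff)
  finally show ?thesis .
qed

section \<open>Standard Gaussian vectors and their rotations\<close>

lemma nn_integral_lborel_affine:
  fixes f :: "'a::euclidean_space \<Rightarrow> ennreal"
  assumes [measurable]: "f \<in> borel_measurable borel" and "c \<noteq> 0"
  shows "(\<integral>\<^sup>+ x. f x \<partial>lborel) = ennreal (\<bar>c\<bar> ^ DIM('a)) * (\<integral>\<^sup>+ x. f (t + c *\<^sub>R x) \<partial>lborel)"
  by (subst lborel_affine[OF assms(2), of t])
    (simp add: nn_integral_density nn_integral_distr nn_integral_cmult)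

definition gauss_density :: "real^'p \<Rightarrow> real" where
  "gauss_density x = (\<Prod>i\<in>UNIV. std_normal_density (x $ i))"

lemma gauss_density_eq: "gauss_density (x::real^'p) = (1 / sqrt (2 * pi)) ^ CARD('p) * exp (- (x \<bullet> x) / 2)"
proof -
  have "gauss_density x = (\<Prod>i\<in>(UNIV::'p set). 1 / sqrt (2 * pi)) * (\<Prod>i\<in>UNIV. exp (- ((x $ i)^2) / 2))"
    unfolding gauss_density_def std_normal_density_def prod.distrib by simp
  also have "(\<Prod>i\<in>UNIV. exp (- ((x $ i)^2) / 2)) = exp (\<Sum>i\<in>UNIV. - ((x $ i)^2) / 2)"
    by (simp add: exp_sum)
  also have "(\<Sum>i\<in>UNIV. - ((x $ i)^2) / 2) = - (x \<bullet> x) / 2"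
    by (simp add: inner_vec_def power2_eq_square sum_negf sum_divide_distrib[symmetric])
  finally show ?thesis by simp
qed

lemma gauss_density_nonneg [simp]: "0 \<le> gauss_density x"
  by (simp add: gauss_density_eq)

lemma borel_measurable_gauss_density [measurable]: "gauss_density \<in> borel_measurable borel"
  unfolding gauss_density_eq[abs_def] by measurable

definition std_gauss :: "(real^'p) measure" where
  "std_gauss = density lborel (\<lambda>x. ennreal (gauss_density x))"

lemma sets_std_gauss [simp, measurable_cong]: "sets std_gauss = sets borel"
  by (simp add: std_gauss_def)

lemma borel_measurable_vec_lambda:
  fixes f :: "'a \<Rightarrow> 'p::finite \<Rightarrow> real"
  assumes "\<And>i. (\<lambda>x. f x i) \<in> borel_measurable M"
  shows "(\<lambda>x. \<chi> i. f x i) \<in> borel_measurable M"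
proof (subst borel_measurable_euclidean_space, intro ballI)
  fix b :: "real^'p" assume "b \<in> Basis"
  then obtain i where "b = axis i 1" by (auto simp: Basis_vec_def)
  then show "(\<lambda>x. (\<chi> i. f x i) \<bullet> b) \<in> borel_measurable M"
    using assms by (simp add: inner_axis)
qed

text \<open>
  Identifies Lebesgue measure on vectors with the product over the index type itself, so that Fubini's
  theorem can split off a single coordinate.
\<close>

lemma lborel_vec_eq_PiM:
  "(lborel :: (real^'p) measure) = distr (\<Pi>\<^sub>M i\<in>(UNIV::'p set). lborel) borel (\<lambda>g. \<chi> i. g i)"
proof (rule lborel_eqI)
  interpret product_sigma_finite "\<lambda>_::'p. lborel :: real measure"
    by standard
  have m: "(\<lambda>g. \<chi> i. g i) \<in> (\<Pi>\<^sub>M i\<in>(UNIV::'p set). lborel) \<rightarrow>\<^sub>M (borel :: (real^'p) measure)"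
    by (rule borel_measurable_vec_lambda) measurable
  fix l u :: "real^'p"
  assume le: "\<And>b. b \<in> Basis \<Longrightarrow> l \<bullet> b \<le> u \<bullet> b"
  have le': "l $ i \<le> u $ i" for i
    using le[of "axis i 1"] by (simp add: inner_axis)
  have "(\<lambda>g. \<chi> i. g i) -` box l u \<inter> space (\<Pi>\<^sub>M i\<in>(UNIV::'p set). lborel)
      = (\<Pi>\<^sub>E i\<in>UNIV. {l $ i <..< u $ i})"
    by (auto simp: space_PiM mem_box_cart PiE_def Pi_def)
  then have "emeasure (distr (\<Pi>\<^sub>M i\<in>(UNIV::'p set). lborel) borel (\<lambda>g. \<chi> i. g i)) (box l u)
      = (\<Prod>i\<in>(UNIV::'p set). emeasure lborel {l $ i <..< u $ i})"
    using m by (simp add: emeasure_distr emeasure_PiM)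
  also have "\<dots> = ennreal (\<Prod>i\<in>(UNIV::'p set). u $ i - l $ i)"
    using le' by (simp add: prod_ennreal)
  also have "(\<Prod>i\<in>(UNIV::'p set). u $ i - l $ i) = (\<Prod>b\<in>Basis. (u - l) \<bullet> b)"
  proof -
    have B: "(Basis :: (real^'p) set) = (\<lambda>i. axis i 1) ` UNIV" by (auto simp: Basis_vec_def)
    have "inj (\<lambda>i::'p. axis i (1::real))" by (auto simp: inj_def axis_eq_axis)
    then show ?thesis unfolding B by (subst prod.reindex) (simp_all add: inner_axis)
  qed
  finally show "emeasure (distr (\<Pi>\<^sub>M i\<in>(UNIV::'p set). lborel) borel (\<lambda>g. \<chi> i. g i)) (box l u)
    = (\<Prod>b\<in>Basis. (u - l) \<bullet> b)" .
qed simp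

definition replace_coord :: "'p \<Rightarrow> real \<Rightarrow> real^'p \<Rightarrow> real^'p" where
  "replace_coord a x y = (\<chi> i. if i = a then x else y $ i)"

lemma measurable_replace_coord [measurable (raw)]:
  fixes a :: "'p::finite"
  assumes [measurable]: "f \<in> borel_measurable M" "g \<in> borel_measurable M"
  shows "(\<lambda>z. replace_coord a (f z) (g z)) \<in> borel_measurable M"
  unfolding replace_coord_def
proof (rule borel_measurable_vec_lambda)
  fix i :: 'p
  show "(\<lambda>z. if i = a then f z else g z $ i) \<in> borel_measurable M"
  proof (cases "i = a")
    case False
    have [measurable]: "(\<lambda>y::real^'p. y $ i) \<in> borel_measurable borel"
      by (intro borel_measurable_continuous_onI continuous_intros)
    then show ?thesis using False by simp
  qed simp
qed

lemma nn_integral_lborel_vec_insert: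
  fixes f :: "real^'p \<Rightarrow> ennreal"
  assumes [measurable]: "f \<in> borel_measurable borel"
  shows "(\<integral>\<^sup>+ y. f y \<partial>lborel)
    = (\<integral>\<^sup>+ t. \<integral>\<^sup>+ g. f (\<chi> i. if i = a then t else g i) \<partial>(\<Pi>\<^sub>M i\<in>UNIV - {a}. lborel) \<partial>lborel)"
proof -
  interpret product_sigma_finite "\<lambda>_::'p. lborel :: real measure"
    by standard
  have U: "insert a (UNIV - {a}) = (UNIV :: 'p set)" by auto
  have [measurable]: "(\<lambda>g. \<chi> i. g i) \<in> (\<Pi>\<^sub>M i\<in>(UNIV::'p set). lborel) \<rightarrow>\<^sub>M (borel :: (real^'p) measure)"
    by (rule borel_measurable_vec_lambda) measurable
  have "(\<integral>\<^sup>+ y. f y \<partial>lborel) = (\<integral>\<^sup>+ g. f (\<chi> i. g i) \<partial>(\<Pi>\<^sub>M i\<in>UNIV. lborel))"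
    by (subst lborel_vec_eq_PiM, subst nn_integral_distr) simp_all
  also have "\<dots> = (\<integral>\<^sup>+ t. \<integral>\<^sup>+ g. f (\<chi> i. (g(a := t)) i) \<partial>(\<Pi>\<^sub>M i\<in>UNIV - {a}. lborel) \<partial>lborel)"
    using product_nn_integral_insert_rev[of "UNIV - {a}" a "\<lambda>g. f (\<chi> i. g i)"] by (simp add: U)
  finally show ?thesis by (simp add: fun_upd_def)
qed

text \<open>
  The coordinates of a standard Gaussian vector are independent: exchanging one of them for
  a fresh normal variable does not change the law.
\<close>

lemma nn_integral_std_gauss_replace_coord:
  fixes f :: "real^'p \<Rightarrow> ennreal"
  assumes [measurable]: "f \<in> borel_measurable borel"
  shows "(\<integral>\<^sup>+ y. f y \<partial>std_gauss)
    = (\<integral>\<^sup>+ x. \<integral>\<^sup>+ y. f (replace_coord a x y) \<partial>std_gauss \<partial>std_normal)"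
proof -
  define D where "D g = ennreal (\<Prod>i\<in>UNIV - {a}. std_normal_density (g i))" for g :: "'p \<Rightarrow> real"
  define P where "P = (\<Pi>\<^sub>M i\<in>UNIV - {a}. lborel :: real measure)"
  have P: "sigma_finite_measure P"
    unfolding P_def
    by (rule product_sigma_finite.sigma_finite) (auto simp: product_sigma_finite_def sigma_finite_lborel)
  interpret P: sigma_finite_measure P by fact
  have [measurable]: "D \<in> borel_measurable P"
    unfolding D_def P_def by measurable
  have m: "(\<lambda>g. \<chi> i. if i = a then x else g i) \<in> P \<rightarrow>\<^sub>M (borel :: (real^'p) measure)" for x
  proof (rule borel_measurable_vec_lambda)
    fix i
    show "(\<lambda>g. if i = a then x else g i) \<in> borel_measurable P"
      unfolding P_def by (cases "i = a") simp_all
  qed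
  have split: "ennreal (gauss_density (\<chi> i. if i = a then t else g i)) = ennreal (std_normal_density t) * D g" for t g
  proof -
    have "gauss_density (\<chi> i. if i = a then t else g i)
        = std_normal_density t * (\<Prod>i\<in>UNIV - {a}. std_normal_density (g i))"
      unfolding gauss_density_def by (subst prod.remove[of _ a]) (auto intro!: prod.cong)
    then show ?thesis by (simp add: D_def ennreal_mult')
  qed
  have "(\<integral>\<^sup>+ x. \<integral>\<^sup>+ y. f (replace_coord a x y) \<partial>std_gauss \<partial>std_normal)
      = (\<integral>\<^sup>+ x. (\<integral>\<^sup>+ g. D g * f (\<chi> i. if i = a then x else g i) \<partial>P) \<partial>std_normal)"
  proof (intro nn_integral_cong)
    fix x :: real
    have "(\<integral>\<^sup>+ y. f (replace_coord a x y) \<partial>std_gauss)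
        = (\<integral>\<^sup>+ t. \<integral>\<^sup>+ g. ennreal (std_normal_density t) * (D g * f (\<chi> i. if i = a then x else g i)) \<partial>P \<partial>lborel)"
      unfolding std_gauss_def
      by (subst nn_integral_density, simp, simp, subst nn_integral_lborel_vec_insert[of _ a], simp)
        (auto simp: split P_def mult.assoc replace_coord_def cong: if_cong intro!: nn_integral_cong)
    also have "\<dots> = (\<integral>\<^sup>+ t. ennreal (std_normal_density t) * (\<integral>\<^sup>+ g. D g * f (\<chi> i. if i = a then x else g i) \<partial>P) \<partial>lborel)"
      using m[of x] by (intro nn_integral_cong nn_integral_cmult) measurable
    also have "\<dots> = (\<integral>\<^sup>+ t. ennreal (std_normal_density t) \<partial>lborel) * (\<integral>\<^sup>+ g. D g * f (\<chi> i. if i = a then x else g i) \<partial>P)"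
      by (rule nn_integral_multc) simp
    also have "(\<integral>\<^sup>+ t. ennreal (std_normal_density t) \<partial>lborel) = 1"
      by (simp add: nn_integral_eq_integral)
    finally show "(\<integral>\<^sup>+ y. f (replace_coord a x y) \<partial>std_gauss)
      = (\<integral>\<^sup>+ g. D g * f (\<chi> i. if i = a then x else g i) \<partial>P)" by simp
  qed
  also have "\<dots> = (\<integral>\<^sup>+ x. ennreal (std_normal_density x) * (\<integral>\<^sup>+ g. D g * f (\<chi> i. if i = a then x else g i) \<partial>P) \<partial>lborel)"
  proof (rule nn_integral_density)
    have "(\<lambda>z. D (snd z) * f (\<chi> i. if i = a then fst z else snd z i)) \<in> borel_measurable (lborel \<Otimes>\<^sub>M P)"
    proof -
      have "(\<lambda>z. \<chi> i. if i = a then fst z else snd z i) \<in> lborel \<Otimes>\<^sub>M P \<rightarrow>\<^sub>M (borel :: (real^'p) measure)"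
      proof (rule borel_measurable_vec_lambda)
        fix i
        show "(\<lambda>z. if i = a then fst z else snd z i) \<in> borel_measurable (lborel \<Otimes>\<^sub>M P)"
        proof (cases "i = a")
          case False
          have "(\<lambda>g. g i) \<in> borel_measurable P"
            unfolding P_def using measurable_component_singleton[of i "UNIV - {a}" "\<lambda>_. lborel"] False by simp
          then show ?thesis using False by simp
        qed simp
      qed
      then show ?thesis by measurable
    qed
    then show "(\<lambda>x. \<integral>\<^sup>+ g. D g * f (\<chi> i. if i = a then x else g i) \<partial>P) \<in> borel_measurable lborel"
      by measurable
  qed simp
  also have "\<dots> = (\<integral>\<^sup>+ x. \<integral>\<^sup>+ g. ennreal (std_normal_density x) * D g * f (\<chi> i. if i = a then x else g i) \<partial>P \<partial>lborel)"
    using m by (intro nn_integral_cong) (simp add: nn_integral_cmult[symmetric] mult.assoc)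
  also have "\<dots> = (\<integral>\<^sup>+ y. f y \<partial>std_gauss)"
    unfolding std_gauss_def
    by (subst nn_integral_density, simp, simp, subst nn_integral_lborel_vec_insert[of _ a], simp)
      (simp add: split P_def)
  finally show ?thesis ..
qed

lemma prob_space_std_gauss: "prob_space (std_gauss :: (real^'p) measure)"
proof
  interpret product_sigma_finite "\<lambda>_::'p. lborel :: real measure"
    by standard
  have [measurable]: "(\<lambda>g. \<chi> i. g i) \<in> (\<Pi>\<^sub>M i\<in>(UNIV::'p set). lborel) \<rightarrow>\<^sub>M (borel :: (real^'p) measure)"
    by (rule borel_measurable_vec_lambda) measurable
  have "emeasure (std_gauss :: (real^'p) measure) (space std_gauss) = (\<integral>\<^sup>+ x. ennreal (gauss_density (x::real^'p)) \<partial>lborel)"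
    by (simp add: std_gauss_def emeasure_density)
  also have "\<dots> = (\<integral>\<^sup>+ g. (\<Prod>i\<in>(UNIV::'p set). ennreal (std_normal_density (g i))) \<partial>(\<Pi>\<^sub>M i\<in>UNIV. lborel))"
    by (subst lborel_vec_eq_PiM, subst nn_integral_distr) (simp_all add: gauss_density_def prod_ennreal)
  also have "\<dots> = 1"
    by (subst product_nn_integral_prod) (simp_all add: nn_integral_eq_integral)
  finally show "emeasure (std_gauss :: (real^'p) measure) (space std_gauss) = 1" .
qed

text \<open>
  Two independent vectors with law \<open>K\<close> may be rotated into each other.  This is the only property
  of Gaussian vectors that the regression argument uses.
\<close>

definition rotation_invariant :: "'a::euclidean_space measure \<Rightarrow> bool" where
  "rotation_invariant K \<longleftrightarrow> (\<forall>c s h. c^2 + s^2 = 1 \<longrightarrow> h \<in> borel_measurable (borel \<Otimes>\<^sub>M borel) \<longrightarrow>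
     (\<integral>\<^sup>+ u. \<integral>\<^sup>+ y. h (c *\<^sub>R u + s *\<^sub>R y, c *\<^sub>R y - s *\<^sub>R u) \<partial>K \<partial>K) = (\<integral>\<^sup>+ u. \<integral>\<^sup>+ y. h (u, y) \<partial>K \<partial>K))"

text \<open>
  For \<open>c \<noteq> 0\<close> the rotation is performed as two successive affine substitutions, one in each variable,
  whose Jacobians \<open>\<bar>1 / c\<bar>\<close> and \<open>\<bar>c\<bar>\<close> (to the power of the dimension) cancel; for \<open>c = 0\<close> it
  exchanges the variables up to signs.
\<close>

lemma nn_integral_lborel_rotate:
  fixes H :: "'a::euclidean_space \<times> 'a \<Rightarrow> ennreal"
  assumes [measurable]: "H \<in> borel_measurable (borel \<Otimes>\<^sub>M borel)" and cs: "c^2 + s^2 = 1"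
  shows "(\<integral>\<^sup>+ u. \<integral>\<^sup>+ y. H (c *\<^sub>R u + s *\<^sub>R y, c *\<^sub>R y - s *\<^sub>R u) \<partial>lborel \<partial>lborel)
    = (\<integral>\<^sup>+ u. \<integral>\<^sup>+ y. H (u, y) \<partial>lborel \<partial>lborel)"
proof (cases "c = 0")
  case True
  then have s: "s = 1 \<or> s = - 1" using cs by (simp add: power2_eq_1_iff)
  have flip: "(\<integral>\<^sup>+ y. f (s *\<^sub>R y) \<partial>lborel) = (\<integral>\<^sup>+ y. f y \<partial>lborel)"
    if [measurable]: "f \<in> borel_measurable borel" for f :: "'a \<Rightarrow> ennreal"
    using nn_integral_lborel_affine[of f s 0] s by auto
  have flip': "(\<integral>\<^sup>+ y. f (- (s *\<^sub>R y)) \<partial>lborel) = (\<integral>\<^sup>+ y. f y \<partial>lborel)"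
    if [measurable]: "f \<in> borel_measurable borel" for f :: "'a \<Rightarrow> ennreal"
    using nn_integral_lborel_affine[of f "- s" 0] s by auto
  have "(\<integral>\<^sup>+ u. \<integral>\<^sup>+ y. H (s *\<^sub>R y, - (s *\<^sub>R u)) \<partial>lborel \<partial>lborel)
      = (\<integral>\<^sup>+ u. \<integral>\<^sup>+ y. H (y, - (s *\<^sub>R u)) \<partial>lborel \<partial>lborel)"
    by (intro nn_integral_cong flip) simp
  also have "\<dots> = (\<integral>\<^sup>+ y. \<integral>\<^sup>+ u. H (y, - (s *\<^sub>R u)) \<partial>lborel \<partial>lborel)"
    by (rule lborel_pair.Fubini') simp
  also have "\<dots> = (\<integral>\<^sup>+ y. \<integral>\<^sup>+ u. H (y, u) \<partial>lborel \<partial>lborel)"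
    by (intro nn_integral_cong flip') simp
  finally show ?thesis using True by simp
next
  case False
  define k where "k = ennreal (\<bar>1 / c\<bar> ^ DIM('a))"
  define k' where "k' = ennreal (\<bar>c\<bar> ^ DIM('a))"
  have kk': "k * k' = 1"
    using False by (simp add: k_def k'_def ennreal_mult'[symmetric] power_mult_distrib[symmetric])
  have "(\<integral>\<^sup>+ u. \<integral>\<^sup>+ y. H (c *\<^sub>R u + s *\<^sub>R y, c *\<^sub>R y - s *\<^sub>R u) \<partial>lborel \<partial>lborel)
      = (\<integral>\<^sup>+ y. \<integral>\<^sup>+ u. H (c *\<^sub>R u + s *\<^sub>R y, c *\<^sub>R y - s *\<^sub>R u) \<partial>lborel \<partial>lborel)"
    by (rule lborel_pair.Fubini') simp
  also have "\<dots> = (\<integral>\<^sup>+ y. k * (\<integral>\<^sup>+ a. H (a, (1 / c) *\<^sub>R (y - s *\<^sub>R a)) \<partial>lborel) \<partial>lborel)"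
  proof (intro nn_integral_cong)
    fix y :: 'a
    have 1: "c *\<^sub>R ((- s / c) *\<^sub>R y + (1 / c) *\<^sub>R a) + s *\<^sub>R y = a" for a
      using False by (simp add: algebra_simps)
    have 2: "c *\<^sub>R y - s *\<^sub>R ((- s / c) *\<^sub>R y + (1 / c) *\<^sub>R a) = (1 / c) *\<^sub>R (y - s *\<^sub>R a)" for a
    proof -
      have "c *\<^sub>R y - s *\<^sub>R ((- s / c) *\<^sub>R y + (1 / c) *\<^sub>R a) = (c + s * s / c) *\<^sub>R y - (s / c) *\<^sub>R a"
        by (simp add: algebra_simps)
      also have "c + s * s / c = 1 / c"
        using False cs by (simp add: field_simps power2_eq_square)
      finally show ?thesis by (simp add: algebra_simps)
    qed
    show "(\<integral>\<^sup>+ u. H (c *\<^sub>R u + s *\<^sub>R y, c *\<^sub>R y - s *\<^sub>R u) \<partial>lborel)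
      = k * (\<integral>\<^sup>+ a. H (a, (1 / c) *\<^sub>R (y - s *\<^sub>R a)) \<partial>lborel)"
      using False
      by (subst nn_integral_lborel_affine[of _ "1 / c" "(- s / c) *\<^sub>R y"]) (simp_all only: 1 2 k_def, simp_all)
  qed
  also have "\<dots> = k * (\<integral>\<^sup>+ y. \<integral>\<^sup>+ a. H (a, (1 / c) *\<^sub>R (y - s *\<^sub>R a)) \<partial>lborel \<partial>lborel)"
    by (rule nn_integral_cmult) measurable
  also have "(\<integral>\<^sup>+ y. \<integral>\<^sup>+ a. H (a, (1 / c) *\<^sub>R (y - s *\<^sub>R a)) \<partial>lborel \<partial>lborel)
      = (\<integral>\<^sup>+ a. \<integral>\<^sup>+ y. H (a, (1 / c) *\<^sub>R (y - s *\<^sub>R a)) \<partial>lborel \<partial>lborel)"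
    by (rule lborel_pair.Fubini') simp
  also have "\<dots> = (\<integral>\<^sup>+ a. k' * (\<integral>\<^sup>+ b. H (a, b) \<partial>lborel) \<partial>lborel)"
  proof (intro nn_integral_cong)
    fix a :: 'a
    show "(\<integral>\<^sup>+ y. H (a, (1 / c) *\<^sub>R (y - s *\<^sub>R a)) \<partial>lborel) = k' * (\<integral>\<^sup>+ b. H (a, b) \<partial>lborel)"
      using False by (subst nn_integral_lborel_affine[of _ c "s *\<^sub>R a"]) (simp_all add: k'_def)
  qed
  also have "\<dots> = k' * (\<integral>\<^sup>+ a. \<integral>\<^sup>+ b. H (a, b) \<partial>lborel \<partial>lborel)"
    by (rule nn_integral_cmult) measurable
  finally show ?thesis by (simp add: mult.assoc[symmetric] kk')
qed

text \<open>
  The joint density depends on \<open>u \<bullet> u + y \<bullet> y\<close> only, which a rotation preserves.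
\<close>

lemma rotation_invariant_std_gauss: "rotation_invariant (std_gauss :: (real^'p) measure)"
  unfolding rotation_invariant_def
proof (intro allI impI)
  fix c s :: real and h :: "(real^'p) \<times> (real^'p) \<Rightarrow> ennreal"
  assume cs: "c^2 + s^2 = 1" and [measurable]: "h \<in> borel_measurable (borel \<Otimes>\<^sub>M borel)"
  define H where "H z = ennreal (gauss_density (fst z)) * ennreal (gauss_density (snd z)) * h z" for z
  have [measurable]: "H \<in> borel_measurable (borel \<Otimes>\<^sub>M borel)" unfolding H_def by measurable
  have expand: "(\<integral>\<^sup>+ u. \<integral>\<^sup>+ y. f (u, y) \<partial>std_gauss \<partial>std_gauss)
      = (\<integral>\<^sup>+ u. \<integral>\<^sup>+ y. ennreal (gauss_density u) * ennreal (gauss_density y) * f (u, y) \<partial>lborel \<partial>lborel)"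
    if [measurable]: "f \<in> borel_measurable (borel \<Otimes>\<^sub>M borel)" for f :: "(real^'p) \<times> (real^'p) \<Rightarrow> ennreal"
    unfolding std_gauss_def
    by (simp add: nn_integral_density nn_integral_cmult[symmetric] mult.assoc)
  have g: "ennreal (gauss_density u) * ennreal (gauss_density y)
     = ennreal (gauss_density (c *\<^sub>R u + s *\<^sub>R y)) * ennreal (gauss_density (c *\<^sub>R y - s *\<^sub>R u))" for u y :: "real^'p"
  proof -
    have "(c *\<^sub>R u + s *\<^sub>R y) \<bullet> (c *\<^sub>R u + s *\<^sub>R y) + (c *\<^sub>R y - s *\<^sub>R u) \<bullet> (c *\<^sub>R y - s *\<^sub>R u)
        = (c^2 + s^2) * (u \<bullet> u + y \<bullet> y)"
      by (simp add: inner_add_left inner_add_right inner_diff_left inner_diff_right inner_commute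
          power2_eq_square algebra_simps)
    then have "exp (- (u \<bullet> u) / 2) * exp (- (y \<bullet> y) / 2)
      = exp (- ((c *\<^sub>R u + s *\<^sub>R y) \<bullet> (c *\<^sub>R u + s *\<^sub>R y)) / 2) * exp (- ((c *\<^sub>R y - s *\<^sub>R u) \<bullet> (c *\<^sub>R y - s *\<^sub>R u)) / 2)"
      unfolding exp_add[symmetric] cs by (intro arg_cong[where f = exp]) (simp add: field_simps)
    then show ?thesis
      by (simp add: gauss_density_eq ennreal_mult'[symmetric])
  qed
  have "(\<integral>\<^sup>+ u. \<integral>\<^sup>+ y. h (c *\<^sub>R u + s *\<^sub>R y, c *\<^sub>R y - s *\<^sub>R u) \<partial>std_gauss \<partial>std_gauss)
      = (\<integral>\<^sup>+ u. \<integral>\<^sup>+ y. H (c *\<^sub>R u + s *\<^sub>R y, c *\<^sub>R y - s *\<^sub>R u) \<partial>lborel \<partial>lborel)"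
    using expand[of "\<lambda>z. h (c *\<^sub>R fst z + s *\<^sub>R snd z, c *\<^sub>R snd z - s *\<^sub>R fst z)"]
    by (simp add: H_def g[symmetric])
  also have "\<dots> = (\<integral>\<^sup>+ u. \<integral>\<^sup>+ y. H (u, y) \<partial>lborel \<partial>lborel)"
    by (rule nn_integral_lborel_rotate[OF _ cs]) simp
  also have "\<dots> = (\<integral>\<^sup>+ u. \<integral>\<^sup>+ y. h (u, y) \<partial>std_gauss \<partial>std_gauss)"
    by (subst expand) (simp_all add: H_def)
  finally show "(\<integral>\<^sup>+ u. \<integral>\<^sup>+ y. h (c *\<^sub>R u + s *\<^sub>R y, c *\<^sub>R y - s *\<^sub>R u) \<partial>std_gauss \<partial>std_gauss)
    = (\<integral>\<^sup>+ u. \<integral>\<^sup>+ y. h (u, y) \<partial>std_gauss \<partial>std_gauss)" .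
qed

section \<open>Regression through the origin on independent Gaussian data\<close>

lemma sets_borel_pair [measurable_cong]:
  "sets (borel :: ('a::second_countable_topology \<times> 'b::second_countable_topology) measure)
    = sets (borel \<Otimes>\<^sub>M borel)"
  by (rule arg_cong[where f = sets, OF borel_prod[symmetric]])

lemma measurable_outer_product [measurable (raw)]:
  fixes f g :: "'a \<Rightarrow> real^'p"
  assumes [measurable]: "f \<in> borel_measurable M" "g \<in> borel_measurable M"
  shows "(\<lambda>z. outer_product (f z) (g z)) \<in> borel_measurable M"
proof -
  have "(\<lambda>(x :: real^'p, y). outer_product x y) \<in> borel_measurable (borel \<Otimes>\<^sub>M borel)"
    unfolding borel_prod outer_product_def case_prod_beta
    by (intro borel_measurable_continuous_onI continuous_intros)
  then show ?thesis by measurable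
qed

lemma outer_product_scaleR_left: "outer_product (c *\<^sub>R x) z = c *\<^sub>R outer_product x z"
  and outer_product_scaleR_right: "outer_product x (c *\<^sub>R z) = c *\<^sub>R outer_product x z"
  by (auto simp: outer_product_def vec_eq_iff algebra_simps)

text \<open>
  The contribution of one observation \<open>(x, y)\<close> to \<open>(\<Sum> x\<^sup>2, \<Sum> x y, \<Sum> y y\<^sup>T)\<close>, the sufficient
  statistics for regressing \<open>y\<close> on \<open>x\<close> through the origin.
\<close>

definition scatter_increment :: "real measure \<Rightarrow> (real^'p) measure \<Rightarrow> (real \<times> (real^'p) \<times> (real^'p^'p)) measure" where
  "scatter_increment \<rho> K = distr (\<rho> \<Otimes>\<^sub>M K) borel (\<lambda>(x, y). (x^2, x *\<^sub>R y, outer_product y y))"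

lemma sets_scatter_increment [simp, measurable_cong]: "sets (scatter_increment \<rho> K) = sets borel"
  by (simp add: scatter_increment_def)

definition wishart :: "(real^'p) measure \<Rightarrow> nat \<Rightarrow> (real^'p^'p) measure" where
  "wishart K N = iid_sum (distr K borel (\<lambda>y. outer_product y y)) N"

lemma sets_wishart [simp, measurable_cong]: "sets (wishart K N) = sets borel"
  by (simp add: wishart_def)

definition residual :: "real \<times> (real^'p) \<times> (real^'p^'p) \<Rightarrow> real^'p^'p" where
  "residual = (\<lambda>(r, v, M). M - (1 / r) *\<^sub>R outer_product v v)"

text \<open>
  From the sufficient statistics: the sum of squares of the regressor, the normalised regression
  vector, and the residual scatter matrix.  The middle component is needed for the
  induction on the sample size, as it is rotated together with the next observation.
\<close>

definition regress :: "real \<times> (real^'p) \<times> (real^'p^'p) \<Rightarrow> real \<times> (real^'p) \<times> (real^'p^'p)" where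
  "regress = (\<lambda>(r, v, M). (r, (1 / sqrt r) *\<^sub>R v, M - (1 / r) *\<^sub>R outer_product v v))"

lemma measurable_regress [measurable]: "regress \<in> borel_measurable borel"
  unfolding regress_def case_prod_beta by measurable

locale gaussian_design =
  fixes \<rho> :: "real measure" and K :: "(real^'p) measure"
  assumes prob_rho: "prob_space \<rho>" and sets_rho [measurable_cong, simp]: "sets \<rho> = sets borel"
    and rho_nonzero: "AE x in \<rho>. x \<noteq> 0"
    and prob_K: "prob_space K" and sets_K [measurable_cong, simp]: "sets K = sets borel"
    and rot_K: "rotation_invariant K"
begin

sublocale R: prob_space \<rho> by (rule prob_rho)
sublocale K: prob_space K by (rule prob_K)

abbreviation "squares N \<equiv> iid_sum (distr \<rho> borel (\<lambda>x. x^2)) N"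
abbreviation "scatter N \<equiv> iid_sum (scatter_increment \<rho> K) N"

lemma prob_square: "prob_space (distr \<rho> borel (\<lambda>x. x^2))"
  by (rule R.prob_space_distr) simp

lemma prob_outer: "prob_space (distr K borel (\<lambda>y. outer_product y y))"
  by (rule K.prob_space_distr) simp

lemma prob_wishart: "prob_space (wishart K N)"
  unfolding wishart_def by (rule prob_space_iid_sum[OF prob_outer]) simp

sublocale RK: pair_prob_space \<rho> K ..

lemma prob_scatter_increment: "prob_space (scatter_increment \<rho> K)"
  unfolding scatter_increment_def by (rule RK.prob_space_distr) simp

lemma nn_integral_scatter_increment:
  assumes [measurable]: "f \<in> borel_measurable borel"
  shows "(\<integral>\<^sup>+ z. f z \<partial>scatter_increment \<rho> K) = (\<integral>\<^sup>+ x. \<integral>\<^sup>+ y. f (x^2, x *\<^sub>R y, outer_product y y) \<partial>K \<partial>\<rho>)"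
  unfolding scatter_increment_def
  by (simp add: nn_integral_distr K.nn_integral_fst[symmetric] case_prod_beta)

lemma nn_integral_wishart_Suc:
  assumes [measurable]: "f \<in> borel_measurable borel"
  shows "(\<integral>\<^sup>+ A. f A \<partial>wishart K (Suc N)) = (\<integral>\<^sup>+ A. \<integral>\<^sup>+ y. f (A + outer_product y y) \<partial>K \<partial>wishart K N)"
  unfolding wishart_def
  by (subst nn_integral_iid_sum_Suc[OF prob_outer]) (simp_all add: nn_integral_distr)

lemma nn_integral_squares_Suc:
  assumes [measurable]: "f \<in> borel_measurable borel"
  shows "(\<integral>\<^sup>+ r. f r \<partial>squares (Suc N)) = (\<integral>\<^sup>+ r. \<integral>\<^sup>+ x. f (r + x^2) \<partial>\<rho> \<partial>squares N)"
  by (subst nn_integral_iid_sum_Suc[OF prob_square]) (simp_all add: nn_integral_distr)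

lemma AE_scatter_pos: "AE z in scatter (Suc N). 0 < fst z"
proof -
  have "distr (scatter_increment \<rho> K) borel fst = distr (\<rho> \<Otimes>\<^sub>M K) borel (\<lambda>z. (fst z)^2)"
    unfolding scatter_increment_def by (subst distr_distr) (simp_all add: comp_def case_prod_beta)
  also have "\<dots> = distr (distr (\<rho> \<Otimes>\<^sub>M K) \<rho> fst) borel (\<lambda>x. x^2)"
    by (subst distr_distr) (simp_all add: comp_def)
  also have "distr (\<rho> \<Otimes>\<^sub>M K) \<rho> fst = \<rho>"
    by (rule K.distr_pair_fst)
  finally have eq: "distr (scatter (Suc N)) borel fst = squares (Suc N)"
    by (subst distr_iid_sum_linear[OF prob_scatter_increment]) (simp_all add: linear_fst)
  have "AE r in distr (scatter (Suc N)) borel fst. 0 < r"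
    unfolding eq by (rule AE_sum_squares_pos[OF prob_rho sets_rho rho_nonzero])
  then show ?thesis
    by (subst (asm) AE_distr_iff) simp_all
qed

lemma nn_integral_rotate:
  assumes "c^2 + s^2 = 1" "h \<in> borel_measurable (borel \<Otimes>\<^sub>M borel)"
  shows "(\<integral>\<^sup>+ u. \<integral>\<^sup>+ y. h (c *\<^sub>R u + s *\<^sub>R y, c *\<^sub>R y - s *\<^sub>R u) \<partial>K \<partial>K) = (\<integral>\<^sup>+ u. \<integral>\<^sup>+ y. h (u, y) \<partial>K \<partial>K)"
  using rot_K assms unfolding rotation_invariant_def by blast

lemma nn_integral_reflect:
  assumes [measurable]: "f \<in> borel_measurable borel"
  shows "(\<integral>\<^sup>+ y. f (- y) \<partial>K) = (\<integral>\<^sup>+ y. f y \<partial>K)"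
  using nn_integral_rotate[of "- 1" 0 "\<lambda>z. f (fst z)"] by (simp add: K.emeasure_space_1)

text \<open>
  Adding an observation \<open>(x, y)\<close> replaces the normalised regression vector \<open>u\<close> by \<open>c u + s y\<close> with
  \<open>c = sqrt r / t\<close>, \<open>s = x / t\<close>, \<open>t = sqrt (r + x\<^sup>2)\<close>, and adds to the residual matrix the outer square of
  \<open>c y - s u\<close>, because \<open>u u\<^sup>T + y y\<^sup>T\<close> is invariant under the rotation.  Given \<open>x\<close>, the rotated pair has
  the same law as \<open>(u, y)\<close>.
\<close>

lemma nn_integral_regress_step:
  assumes h [measurable]: "h \<in> borel_measurable borel" and r: "r > 0"
  shows "(\<integral>\<^sup>+ u. \<integral>\<^sup>+ y. h (regress (r + x^2, sqrt r *\<^sub>R u + x *\<^sub>R y, A + outer_product u u + outer_product y y)) \<partial>K \<partial>K)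
    = (\<integral>\<^sup>+ u. \<integral>\<^sup>+ y. h (r + x^2, u, A + outer_product y y) \<partial>K \<partial>K)"
proof -
  define t where "t = sqrt (r + x^2)"
  have t: "t > 0" "t^2 = r + x^2" using r by (auto simp: t_def add_pos_nonneg)
  define c s where "c = sqrt r / t" and "s = x / t"
  have cs: "c^2 + s^2 = 1"
    using t(1) r by (simp add: c_def s_def power_divide add_divide_distrib[symmetric] t(2)[symmetric])
  have reg: "regress (r + x^2, sqrt r *\<^sub>R u + x *\<^sub>R y, A + outer_product u u + outer_product y y)
      = (r + x^2, c *\<^sub>R u + s *\<^sub>R y, A + outer_product (c *\<^sub>R y - s *\<^sub>R u) (c *\<^sub>R y - s *\<^sub>R u))" for u y
  proof -
    define w where "w = c *\<^sub>R u + s *\<^sub>R y"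
    have w: "sqrt r *\<^sub>R u + x *\<^sub>R y = t *\<^sub>R w"
      using t by (simp add: w_def c_def s_def scaleR_add_right)
    have ww: "(1 / (r + x^2)) *\<^sub>R outer_product (t *\<^sub>R w) (t *\<^sub>R w) = outer_product w w"
      unfolding t(2)[symmetric] using t(1)
      by (simp add: outer_product_scaleR_left outer_product_scaleR_right power2_eq_square)
    have e: "c * c = 1 - s * s" using cs by (simp add: power2_eq_square)
    have "u $ i * u $ j + (y $ i * y $ j - (c * u $ i + s * y $ i) * (c * u $ j + s * y $ j))
        = (c * y $ i - s * u $ i) * (c * y $ j - s * u $ j)" for i j
      using e by algebra
    then have "A + outer_product u u + outer_product y y - outer_product w w
        = A + outer_product (c *\<^sub>R y - s *\<^sub>R u) (c *\<^sub>R y - s *\<^sub>R u)"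
      by (simp add: w_def outer_product_def vec_eq_iff)
    moreover have "(1 / sqrt (r + x^2)) *\<^sub>R (t *\<^sub>R w) = w" using t(1) by (simp add: t_def)
    ultimately show ?thesis unfolding w regress_def prod.case ww by (simp add: w_def)
  qed
  show ?thesis
    unfolding reg
    by (rule nn_integral_rotate[OF cs, of "\<lambda>(u, y). h (r + x^2, u, A + outer_product y y)", simplified]) measurable
qed

text \<open>
  The three components are independent: one observation is absorbed by the regression
  vector, and the residual matrix is a Wishart matrix built from the remaining \<open>N\<close> observations.
  The induction starts from one observation, where the residual vanishes and the regression vector
  is \<open>y\<close> up to the sign of \<open>x\<close>.
\<close>

lemma nn_integral_regress:
  assumes h [measurable]: "h \<in> borel_measurable borel"
  shows "(\<integral>\<^sup>+ z. h (regress z) \<partial>scatter (Suc N))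
    = (\<integral>\<^sup>+ r. \<integral>\<^sup>+ A. \<integral>\<^sup>+ u. h (r, u, A) \<partial>K \<partial>wishart K N \<partial>squares (Suc N))"
  using assms
proof (induction N arbitrary: h)
  case 0
  have [measurable]: "h \<in> borel_measurable borel" by fact
  have "(\<integral>\<^sup>+ z. h (regress z) \<partial>scatter (Suc 0))
      = (\<integral>\<^sup>+ x. \<integral>\<^sup>+ y. h (regress (x^2, x *\<^sub>R y, outer_product y y)) \<partial>K \<partial>\<rho>)"
    by (subst nn_integral_iid_sum_Suc[OF prob_scatter_increment])
      (simp_all add: nn_integral_iid_sum_0 nn_integral_scatter_increment del: iid_sum.simps)
  also have "\<dots> = (\<integral>\<^sup>+ x. \<integral>\<^sup>+ u. h (x^2, u, 0) \<partial>K \<partial>\<rho>)"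
  proof (rule nn_integral_cong_AE)
    show "AE x in \<rho>. (\<integral>\<^sup>+ y. h (regress (x^2, x *\<^sub>R y, outer_product y y)) \<partial>K) = (\<integral>\<^sup>+ u. h (x^2, u, 0) \<partial>K)"
      using rho_nonzero
    proof eventually_elim
      case (elim x)
      have "regress (x^2, x *\<^sub>R y, outer_product y y) = (x^2, (x / \<bar>x\<bar>) *\<^sub>R y, 0)" for y :: "real^'p"
        using elim by (simp add: regress_def outer_product_scaleR_left outer_product_scaleR_right power2_eq_square)
      then show ?case
        using elim nn_integral_reflect[of "\<lambda>u. h (x^2, u, 0)"] by (cases "x > 0") (simp_all add: abs_if)
    qed
  qed
  also have "\<dots> = (\<integral>\<^sup>+ r. \<integral>\<^sup>+ A. \<integral>\<^sup>+ u. h (r, u, A) \<partial>K \<partial>wishart K 0 \<partial>squares (Suc 0))"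
    unfolding wishart_def
    by (subst nn_integral_squares_Suc)
      (simp_all add: nn_integral_iid_sum_0 del: iid_sum.simps)
  finally show ?case .
next
  case (Suc N)
  have [measurable]: "h \<in> borel_measurable borel" by fact
  interpret W: prob_space "wishart K N" by (rule prob_wishart)
  interpret W': prob_space "wishart K (Suc N)" by (rule prob_wishart)
  interpret Sq: prob_space "squares (Suc N)" by (rule prob_space_iid_sum[OF prob_square]) simp
  interpret WR: pair_prob_space "wishart K N" \<rho> ..
  interpret KR: pair_prob_space K \<rho> ..
  interpret KK: pair_prob_space K K ..
  define G where "G = (\<lambda>(r, u, A). \<integral>\<^sup>+ x. \<integral>\<^sup>+ y.
    h (regress (r + x^2, sqrt r *\<^sub>R u + x *\<^sub>R y, A + outer_product u u + outer_product y y)) \<partial>K \<partial>\<rho>)"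
  have G [measurable]: "G \<in> borel_measurable borel"
    unfolding G_def case_prod_beta by measurable
  have "(\<integral>\<^sup>+ z. h (regress z) \<partial>scatter (Suc (Suc N)))
      = (\<integral>\<^sup>+ z. \<integral>\<^sup>+ x. \<integral>\<^sup>+ y. h (regress (z + (x^2, x *\<^sub>R y, outer_product y y))) \<partial>K \<partial>\<rho> \<partial>scatter (Suc N))"
    by (subst nn_integral_iid_sum_Suc[OF prob_scatter_increment])
      (simp_all add: nn_integral_scatter_increment del: iid_sum.simps)
  also have "\<dots> = (\<integral>\<^sup>+ z. G (regress z) \<partial>scatter (Suc N))"
  proof (rule nn_integral_cong_AE)
    show "AE z in scatter (Suc N). (\<integral>\<^sup>+ x. \<integral>\<^sup>+ y. h (regress (z + (x^2, x *\<^sub>R y, outer_product y y))) \<partial>K \<partial>\<rho>) = G (regress z)"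
      using AE_scatter_pos
    proof eventually_elim
      case (elim z)
      obtain r v M where z: "z = (r, v, M)" by (cases z)
      then show ?case
        using elim by (simp add: G_def regress_def[where 'p = 'p] outer_product_scaleR_left outer_product_scaleR_right)
    qed
  qed
  also have "\<dots> = (\<integral>\<^sup>+ r. \<integral>\<^sup>+ A. \<integral>\<^sup>+ u. G (r, u, A) \<partial>K \<partial>wishart K N \<partial>squares (Suc N))"
    by (rule Suc.IH[OF G])
  also have "\<dots> = (\<integral>\<^sup>+ r. \<integral>\<^sup>+ x. \<integral>\<^sup>+ A. \<integral>\<^sup>+ u. h (r + x^2, u, A) \<partial>K \<partial>wishart K (Suc N) \<partial>\<rho> \<partial>squares (Suc N))"
  proof (rule nn_integral_cong_AE)
    show "AE r in squares (Suc N). (\<integral>\<^sup>+ A. \<integral>\<^sup>+ u. G (r, u, A) \<partial>K \<partial>wishart K N)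
      = (\<integral>\<^sup>+ x. \<integral>\<^sup>+ A. \<integral>\<^sup>+ u. h (r + x^2, u, A) \<partial>K \<partial>wishart K (Suc N) \<partial>\<rho>)"
      using AE_sum_squares_pos[OF prob_rho sets_rho rho_nonzero]
    proof eventually_elim
      case (elim r)
      have "(\<integral>\<^sup>+ A. \<integral>\<^sup>+ u. G (r, u, A) \<partial>K \<partial>wishart K N)
          = (\<integral>\<^sup>+ A. \<integral>\<^sup>+ x. \<integral>\<^sup>+ u. \<integral>\<^sup>+ y. h (regress (r + x^2, sqrt r *\<^sub>R u + x *\<^sub>R y, A + outer_product u u + outer_product y y)) \<partial>K \<partial>K \<partial>\<rho> \<partial>wishart K N)"
        unfolding G_def prod.case
        by (intro nn_integral_cong KR.Fubini'[symmetric]) measurable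
      also have "\<dots> = (\<integral>\<^sup>+ A. \<integral>\<^sup>+ x. \<integral>\<^sup>+ u. \<integral>\<^sup>+ y. h (r + x^2, u, A + outer_product y y) \<partial>K \<partial>K \<partial>\<rho> \<partial>wishart K N)"
        by (intro nn_integral_cong nn_integral_regress_step elim) simp
      also have "\<dots> = (\<integral>\<^sup>+ x. \<integral>\<^sup>+ A. \<integral>\<^sup>+ u. \<integral>\<^sup>+ y. h (r + x^2, u, A + outer_product y y) \<partial>K \<partial>K \<partial>wishart K N \<partial>\<rho>)"
        by (rule WR.Fubini'[symmetric]) measurable
      also have "\<dots> = (\<integral>\<^sup>+ x. \<integral>\<^sup>+ A. \<integral>\<^sup>+ y. \<integral>\<^sup>+ u. h (r + x^2, u, A + outer_product y y) \<partial>K \<partial>K \<partial>wishart K N \<partial>\<rho>)"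
        by (intro nn_integral_cong KK.Fubini') measurable
      also have "\<dots> = (\<integral>\<^sup>+ x. \<integral>\<^sup>+ A. \<integral>\<^sup>+ u. h (r + x^2, u, A) \<partial>K \<partial>wishart K (Suc N) \<partial>\<rho>)"
        by (intro nn_integral_cong nn_integral_wishart_Suc[symmetric]) measurable
      finally show ?case .
    qed
  qed
  also have "\<dots> = (\<integral>\<^sup>+ r. \<integral>\<^sup>+ A. \<integral>\<^sup>+ u. h (r, u, A) \<partial>K \<partial>wishart K (Suc N) \<partial>squares (Suc (Suc N)))"
    by (rule nn_integral_squares_Suc[symmetric]) measurable
  finally show ?case .
qed

lemma nn_integral_residual:
  assumes [measurable]: "f \<in> borel_measurable borel"
  shows "(\<integral>\<^sup>+ z. f (fst z, residual z) \<partial>scatter (Suc N))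
    = (\<integral>\<^sup>+ r. \<integral>\<^sup>+ A. f (r, A) \<partial>wishart K N \<partial>squares (Suc N))"
  using nn_integral_regress[of "\<lambda>(r, u, A). f (r, A)" N]
  by (simp add: regress_def residual_def case_prod_beta K.emeasure_space_1 del: iid_sum.simps)

end

section \<open>Schur complements and whitening matrices\<close>

lemma det_column_shear:
  fixes w :: "real^'p"
  assumes "w $ a = 0"
  shows "det (\<chi> i j. (if i = j then 1 else 0) + (if j = a then w $ i else 0) :: real^'p^'p) = 1"
proof -
  define x where "x = (\<Sum>k\<in>UNIV - {a}. w $ k *s row k (mat 1 :: real^'p^'p))"
  have x: "x \<in> vec.span {row j (mat 1 :: real^'p^'p) | j. j \<noteq> a}"
    unfolding x_def by (intro vec.span_sum vec.span_scale vec.span_base) auto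
  have xi: "x $ i = w $ i" for i
  proof -
    have "x $ i = (\<Sum>k\<in>UNIV - {a}. w $ k * (if k = i then 1 else 0))"
      by (simp add: x_def row_def mat_def)
    also have "\<dots> = w $ i" using assms
      by (cases "i = a") (simp_all add: if_distrib[where f = "\<lambda>z. _ * z"] cong: if_cong)
    finally show ?thesis .
  qed
  have "det (\<chi> i j. (if i = j then 1 else 0) + (if j = a then w $ i else 0) :: real^'p^'p)
      = det (transpose (\<chi> k. if k = a then row a (mat 1 :: real^'p^'p) + x else row k (mat 1)))"
    by (intro arg_cong[where f = det]) (auto simp: vec_eq_iff transpose_def row_def mat_def xi)
  also have "\<dots> = 1"
    by (simp only: det_transpose det_row_span[OF x] det_I)
  finally show ?thesis .
qed

text \<open>
  With \<open>L\<close> the column shear by \<open>w / r\<close>, the bordered matrix is \<open>L D L\<^sup>T\<close> where \<open>D\<close> has \<open>r\<close> in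
  position \<open>(a, a)\<close>, zeros elsewhere in that row and column, and the Schur complement in the
  other positions.
\<close>

lemma det_schur_complement:
  fixes C :: "real^'p^'p" and w :: "real^'p"
  assumes r: "r \<noteq> 0"
  shows "det (\<chi> i j. if i = a then (if j = a then r else w $ j) else if j = a then w $ i else C $ i $ j)
    = r * det (\<chi> i j. if i = a \<or> j = a then (if i = j then 1 else 0) else C $ i $ j - w $ i * w $ j / r)"
proof -
  define c :: "real^'p" where "c = (\<chi> i. if i = a then 0 else w $ i / r)"
  define L :: "real^'p^'p" where "L = (\<chi> i j. (if i = j then 1 else 0) + (if j = a then c $ i else 0))"
  define D' :: "real^'p^'p" where
    "D' = (\<chi> i j. if i = a \<or> j = a then (if i = j then 1 else 0) else C $ i $ j - w $ i * w $ j / r)"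
  define D :: "real^'p^'p" where "D = (\<chi> i. if i = a then r *s axis a 1 else D' $ i)"
  have L: "det L = 1" unfolding L_def by (rule det_column_shear) (simp add: c_def)
  have LX: "(L ** X) $ i $ j = X $ i $ j + c $ i * X $ a $ j" for X :: "real^'p^'p" and i j
    by (simp add: matrix_matrix_mult_def L_def distrib_right sum.distrib if_distrib[where f = "\<lambda>z. z * _"] cong: if_cong)
  have XL: "(X ** transpose L) $ i $ j = X $ i $ j + X $ i $ a * c $ j" for X :: "real^'p^'p" and i j
    by (simp add: matrix_matrix_mult_def L_def transpose_def distrib_left sum.distrib if_distrib[where f = "\<lambda>z. _ * z"] cong: if_cong)
  have "(\<chi> i j. if i = a then (if j = a then r else w $ j) else if j = a then w $ i else C $ i $ j)
      = L ** D ** transpose L"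
    using r by (auto simp: vec_eq_iff XL LX D_def D'_def c_def axis_def)
  then have "det (\<chi> i j. if i = a then (if j = a then r else w $ j) else if j = a then w $ i else C $ i $ j) = det D"
    by (simp add: det_mul L)
  also have "\<dots> = r * det (\<chi> i. if i = a then axis a 1 else D' $ i)"
    unfolding D_def by (rule det_row_mul)
  also have "(\<chi> i. if i = a then axis a 1 else D' $ i) = D'"
    by (auto simp: vec_eq_iff D'_def axis_def)
  finally show ?thesis by (simp only: D'_def)
qed

lemma det_scaleR_matrix: "det (c *\<^sub>R A) = c ^ CARD('p) * det (A :: real^'p^'p)"
proof -
  have "c *\<^sub>R A = (\<chi> i. c *s (A $ i))" by (simp add: vec_eq_iff)
  then show ?thesis by (simp only: det_rows_mul) simp
qed

text \<open>
  Gram-Schmidt for the inner product defined by \<open>\<Sigma>\<close>, as an induction over sets of indices: a new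
  basis vector is orthogonal to the images under \<open>\<Sigma>\<close> of the previous ones, which span a proper subspace.
\<close>

lemma orthonormal_wrt_positive_definite:
  fixes \<Sigma> :: "real^'p^'p"
  assumes "positive_definite \<Sigma>"
  obtains B :: "real^'p^'p" where "transpose B ** \<Sigma> ** B = mat 1"
proof -
  have sym: "x \<bullet> (\<Sigma> *v y) = y \<bullet> (\<Sigma> *v x)" for x y
    using assms unfolding positive_definite_def
    by (metis dot_lmul_matrix inner_commute transpose_matrix_vector)
  have pos: "x \<noteq> 0 \<Longrightarrow> x \<bullet> (\<Sigma> *v x) > 0" for x
    using assms unfolding positive_definite_def by blast
  have "\<exists>b. \<forall>i\<in>S. \<forall>j\<in>S. b i \<bullet> (\<Sigma> *v b j) = (if i = j then 1 else 0)" for S :: "'p set"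
    using finite[of S]
  proof (induction S rule: finite_induct)
    case (insert a S)
    then obtain b where b: "\<And>i j. i \<in> S \<Longrightarrow> j \<in> S \<Longrightarrow> b i \<bullet> (\<Sigma> *v b j) = (if i = j then 1 else 0)"
      by blast
    have "dim ((\<lambda>j. \<Sigma> *v b j) ` S) \<le> card S"
      by (rule order_trans[OF dim_le_card' card_image_le]) (use insert in auto)
    also have "\<dots> < CARD('p)"
      using insert.hyps by (intro psubset_card_mono) auto
    finally have "dim ((\<lambda>j. \<Sigma> *v b j) ` S) < DIM(real^'p)" by simp
    then obtain x :: "real^'p" where x: "x \<noteq> 0" "\<And>y. y \<in> span ((\<lambda>j. \<Sigma> *v b j) ` S) \<Longrightarrow> orthogonal x y"
      using orthogonal_to_subspace_exists by blast
    have xb: "x \<bullet> (\<Sigma> *v b j) = 0" if "j \<in> S" for j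
      using x(2)[OF span_base, of "\<Sigma> *v b j"] that by (auto simp: orthogonal_def)
    define q where "q = x \<bullet> (\<Sigma> *v x)"
    have q: "q > 0" using pos[OF x(1)] by (simp add: q_def)
    define z where "z = (1 / sqrt q) *\<^sub>R x"
    have zz: "z \<bullet> (\<Sigma> *v z) = 1"
      using q by (simp add: z_def matrix_vector_mult_scaleR q_def[symmetric])
    have zb: "z \<bullet> (\<Sigma> *v b j) = 0" "b j \<bullet> (\<Sigma> *v z) = 0" if "j \<in> S" for j
      using xb[OF that] sym[of "b j" z] by (simp_all add: z_def)
    show ?case
      using insert.hyps b zz zb by (intro exI[of _ "b(a := z)"]) auto
  qed simp
  from this[of UNIV] obtain b :: "'p \<Rightarrow> real^'p" where b: "\<And>i j. b i \<bullet> (\<Sigma> *v b j) = (if i = j then 1 else 0)"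
    by auto
  define B :: "real^'p^'p" where "B = (\<chi> i j. b j $ i)"
  have "(transpose B ** \<Sigma> ** B) $ i $ j = b i \<bullet> (\<Sigma> *v b j)" for i j
    by (simp add: matrix_mul_assoc[symmetric] matrix_matrix_mult_def matrix_vector_mult_def transpose_def B_def inner_vec_def
        sum_distrib_left sum_distrib_right mult_ac) (rule sum.swap)
  then have "transpose B ** \<Sigma> ** B = mat 1"
    by (simp add: vec_eq_iff b mat_def)
  then show ?thesis by (rule that)
qed

lemma outer_product_linear_image:
  "outer_product (A *v x) (A *v y) = A ** outer_product x y ** transpose A"
  by (simp add: vec_eq_iff outer_product_def matrix_matrix_mult_def matrix_vector_mult_def transpose_def
      sum_product sum_distrib_left sum_distrib_right mult_ac)

lemma matrix_inv_eq_of_whitening: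
  fixes \<Sigma> B :: "real^'p^'p"
  assumes "transpose B ** \<Sigma> ** B = mat 1"
  shows "matrix_inv \<Sigma> = B ** transpose B"
proof -
  have "B ** (transpose B ** \<Sigma>) = mat 1"
    using assms by (subst matrix_left_right_inverse)
  then have 1: "(B ** transpose B) ** \<Sigma> = mat 1" by (simp add: matrix_mul_assoc)
  then have 2: "\<Sigma> ** (B ** transpose B) = mat 1" by (subst matrix_left_right_inverse)
  then have "invertible \<Sigma>" using 1 by (auto simp: invertible_def)
  then have "\<Sigma> ** matrix_inv \<Sigma> = mat 1" "matrix_inv \<Sigma> ** \<Sigma> = mat 1"
    unfolding invertible_def matrix_inv_def by (metis (mono_tags, lifting) someI_ex)+
  then show ?thesis by (metis 1 matrix_mul_assoc matrix_mul_lid matrix_mul_rid)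
qed

lemma det_whitening:
  fixes \<Sigma> B :: "real^'p^'p"
  assumes "transpose B ** \<Sigma> ** B = mat 1"
  shows "det \<Sigma> = 1 / (det B)^2" and "det B \<noteq> 0"
proof -
  have "det (transpose B ** \<Sigma> ** B) = 1" using assms by simp
  then have *: "(det B)^2 * det \<Sigma> = 1" by (simp add: det_mul power2_eq_square mult_ac)
  then show "det B \<noteq> 0" by auto
  then show "det \<Sigma> = 1 / (det B)^2" using * by (simp add: field_simps)
qed

text \<open>
  Uniqueness of translation invariant measures, proved by Fubini's theorem: both sides are the integral of
  \<open>g y * F (y + f x)\<close> for the even density \<open>g = gauss_density\<close>, after translating \<open>x\<close> and \<open>y\<close>
  respectively.  The constant is left as an integral, since normalisation of densities will fix it.
\<close>

lemma nn_integral_lborel_linear_image: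
  fixes f f' :: "real^'p \<Rightarrow> real^'p" and F :: "real^'p \<Rightarrow> ennreal"
  assumes f: "linear f" and f': "\<And>y. f (f' y) = y" and [measurable]: "F \<in> borel_measurable borel"
  shows "(\<integral>\<^sup>+ x. F (f x) \<partial>lborel) = (\<integral>\<^sup>+ x. ennreal (gauss_density (f x)) \<partial>lborel) * (\<integral>\<^sup>+ y. F y \<partial>lborel)"
proof -
  interpret lborel_pair: pair_sigma_finite "lborel :: (real^'p) measure" "lborel :: (real^'p) measure" ..
  define g where "g y = ennreal (gauss_density y)" for y :: "real^'p"
  have [measurable]: "g \<in> borel_measurable borel" unfolding g_def by measurable
  have [measurable]: "f \<in> borel_measurable borel"
    using f by (intro borel_measurable_continuous_onI linear_continuous_on linear_conv_bounded_linear[THEN iffD1])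
  have g1: "(\<integral>\<^sup>+ y. g y \<partial>lborel) = 1"
    using prob_space.emeasure_space_1[OF prob_space_std_gauss[where 'p = 'p]]
    by (simp add: std_gauss_def emeasure_density g_def)
  have shift: "(\<integral>\<^sup>+ x. H (t + x) \<partial>lborel) = (\<integral>\<^sup>+ x. H x \<partial>lborel)"
    if [measurable]: "H \<in> borel_measurable borel" for H :: "real^'p \<Rightarrow> ennreal" and t
    using nn_integral_lborel_affine[of H 1 t] by simp
  have g_even: "g (- y) = g y" for y by (simp add: g_def gauss_density_eq)
  have "(\<integral>\<^sup>+ x. F (f x) \<partial>lborel) = (\<integral>\<^sup>+ y. g y * (\<integral>\<^sup>+ x. F (f x) \<partial>lborel) \<partial>lborel)"
    by (simp add: nn_integral_multc g1)
  also have "\<dots> = (\<integral>\<^sup>+ y. \<integral>\<^sup>+ x. g y * F (y + f x) \<partial>lborel \<partial>lborel)"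
  proof (intro nn_integral_cong)
    fix y
    show "g y * (\<integral>\<^sup>+ x. F (f x) \<partial>lborel) = (\<integral>\<^sup>+ x. g y * F (y + f x) \<partial>lborel)"
      using shift[of "\<lambda>x. F (f x)" "f' y"] by (simp add: nn_integral_cmult linear_add[OF f] f')
  qed
  also have "\<dots> = (\<integral>\<^sup>+ x. \<integral>\<^sup>+ y. g y * F (y + f x) \<partial>lborel \<partial>lborel)"
    by (rule lborel_pair.Fubini'[symmetric]) measurable
  also have "\<dots> = (\<integral>\<^sup>+ x. \<integral>\<^sup>+ y. g (- f x + y) * F y \<partial>lborel \<partial>lborel)"
  proof (rule nn_integral_cong)
    fix x
    show "(\<integral>\<^sup>+ y. g y * F (y + f x) \<partial>lborel) = (\<integral>\<^sup>+ y. g (- f x + y) * F y \<partial>lborel)"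
      using shift[of "\<lambda>y. g (- f x + y) * F y" "f x"] by (simp add: add.commute)
  qed
  also have "\<dots> = (\<integral>\<^sup>+ y. \<integral>\<^sup>+ x. g (- f x + y) * F y \<partial>lborel \<partial>lborel)"
    by (rule lborel_pair.Fubini') measurable
  also have "\<dots> = (\<integral>\<^sup>+ y. (\<integral>\<^sup>+ x. g (f x) \<partial>lborel) * F y \<partial>lborel)"
  proof (intro nn_integral_cong)
    fix y
    show "(\<integral>\<^sup>+ x. g (- f x + y) * F y \<partial>lborel) = (\<integral>\<^sup>+ x. g (f x) \<partial>lborel) * F y"
      using shift[of "\<lambda>x. g (- f x + y)" "f' y"]
      by (simp add: nn_integral_multc linear_add[OF f] f' g_even)
  qed
  also have "\<dots> = (\<integral>\<^sup>+ x. g (f x) \<partial>lborel) * (\<integral>\<^sup>+ y. F y \<partial>lborel)"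
    by (rule nn_integral_cmult) simp
  finally show ?thesis unfolding g_def .
qed

text \<open>
  The constant \<open>\<kappa>\<close> collects the normalising constants and the Jacobian; it equals \<open>1\<close> because both
  laws are probability measures.
\<close>

lemma (in prob_space) distr_whitened_normal:
  fixes X :: "'a \<Rightarrow> real^'p" and \<Sigma> B :: "real^'p^'p"
  assumes B: "transpose B ** \<Sigma> ** B = mat 1"
    and X: "distributed M lborel X (\<lambda>x. ennreal (mvnormal_density \<mu> \<Sigma> x))"
  shows "distr M borel (\<lambda>\<omega>. transpose B *v (X \<omega> - \<mu>)) = std_gauss"
proof -
  define f where "f x = transpose B *v x" for x :: "real^'p"
  have f: "linear f" unfolding f_def by (rule matrix_vector_mul_linear)
  have [measurable]: "f \<in> borel_measurable borel"
    using f by (intro borel_measurable_continuous_onI linear_continuous_on linear_conv_bounded_linear[THEN iffD1])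
  have ff: "f ((\<Sigma> ** B) *v y) = y" for y
    using B by (simp add: f_def matrix_vector_mul_assoc matrix_mul_assoc)
  have [measurable]: "X \<in> borel_measurable M" using distributed_measurable[OF X] by simp
  define C where "C = 1 / sqrt ((2 * pi) ^ CARD('p) * det \<Sigma>) * sqrt (2 * pi) ^ CARD('p)"
  have dens: "mvnormal_density \<mu> \<Sigma> x = C * gauss_density (f (x - \<mu>))" for x
  proof -
    have "(x - \<mu>) \<bullet> (matrix_inv \<Sigma> *v (x - \<mu>)) = f (x - \<mu>) \<bullet> f (x - \<mu>)"
      unfolding matrix_inv_eq_of_whitening[OF B] f_def matrix_vector_mul_assoc[symmetric]
      by (simp add: dot_lmul_matrix[symmetric] transpose_matrix_vector)
    then show ?thesis
      by (simp add: mvnormal_density_def gauss_density_eq C_def power_divide)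
  qed
  have C: "C \<ge> 0" using det_whitening[OF B] by (simp add: C_def)
  define \<kappa> where "\<kappa> = ennreal C * (\<integral>\<^sup>+ x. ennreal (gauss_density (f x)) \<partial>lborel)"
  have law: "(\<integral>\<^sup>+ \<omega>. h (f (X \<omega> - \<mu>)) \<partial>M) = \<kappa> * (\<integral>\<^sup>+ y. h y \<partial>std_gauss)"
    if [measurable]: "h \<in> borel_measurable borel" for h
  proof -
    have "(\<integral>\<^sup>+ \<omega>. h (f (X \<omega> - \<mu>)) \<partial>M)
        = (\<integral>\<^sup>+ x. ennreal (mvnormal_density \<mu> \<Sigma> x) * h (f (x - \<mu>)) \<partial>lborel)"
      by (subst distributed_nn_integral[OF X]) simp_all
    also have "\<dots> = (\<integral>\<^sup>+ x. ennreal C * (ennreal (gauss_density (f x)) * h (f x)) \<partial>lborel)"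
      using nn_integral_lborel_affine[of "\<lambda>x. ennreal (mvnormal_density \<mu> \<Sigma> x) * h (f (x - \<mu>))" 1 \<mu>] C
      by (simp add: dens ennreal_mult' mult.assoc)
    also have "\<dots> = ennreal C * (\<integral>\<^sup>+ x. ennreal (gauss_density (f x)) * h (f x) \<partial>lborel)"
      by (rule nn_integral_cmult) simp
    also have "\<dots> = \<kappa> * (\<integral>\<^sup>+ y. ennreal (gauss_density y) * h y \<partial>lborel)"
      by (subst nn_integral_lborel_linear_image[OF f ff]) (simp_all add: \<kappa>_def mult.assoc)
    also have "(\<integral>\<^sup>+ y. ennreal (gauss_density y) * h y \<partial>lborel) = (\<integral>\<^sup>+ y. h y \<partial>std_gauss)"
      unfolding std_gauss_def by (subst nn_integral_density) simp_all
    finally show ?thesis .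
  qed
  have "\<kappa> = 1"
    using law[of "\<lambda>_. 1"] prob_space.emeasure_space_1[OF prob_space_std_gauss[where 'p = 'p]]
    by (simp add: emeasure_space_1)
  show ?thesis
  proof (rule measure_eqI)
    fix A assume "A \<in> sets (distr M borel (\<lambda>\<omega>. transpose B *v (X \<omega> - \<mu>)))"
    then have A [measurable]: "A \<in> sets borel" by simp
    have "emeasure (distr M borel (\<lambda>\<omega>. f (X \<omega> - \<mu>))) A = (\<integral>\<^sup>+ \<omega>. indicator A (f (X \<omega> - \<mu>)) \<partial>M)"
      by (subst nn_integral_indicator[symmetric], simp, subst nn_integral_distr) auto
    also have "\<dots> = emeasure std_gauss A"
      by (subst law) (simp_all add: \<open>\<kappa> = 1\<close>)
    finally show "emeasure (distr M borel (\<lambda>\<omega>. transpose B *v (X \<omega> - \<mu>))) A = emeasure std_gauss A"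
      by (simp add: f_def)
  qed simp
qed

section \<open>Mellin transform of the determinant of a Wishart matrix\<close>

text \<open>
  Embedded in the full square format by identity entries, so that the induction over the set of
  coordinates stays within one matrix type.
\<close>

definition principal_minor :: "'p set \<Rightarrow> real^'p^'p \<Rightarrow> real" where
  "principal_minor S A = det (\<chi> i j. if i \<in> S \<and> j \<in> S then A $ i $ j else if i = j then 1 else 0)"

lemma principal_minor_empty [simp]: "principal_minor {} (A :: real^'p^'p) = 1"
proof -
  have "(\<chi> i j. if i = j then 1 else 0) = (mat 1 :: real^'p^'p)" by (simp add: mat_def)
  then show ?thesis by (simp add: principal_minor_def)
qed

lemma principal_minor_UNIV [simp]: "principal_minor UNIV A = det A"
  by (simp add: principal_minor_def)

lemma measurable_principal_minor [measurable]: "principal_minor S \<in> borel_measurable borel"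
proof -
  have [measurable]: "(\<lambda>A::real^'p^'p. A $ i $ j) \<in> borel_measurable borel" for i j
    by (intro borel_measurable_continuous_onI continuous_intros)
  show ?thesis
    unfolding principal_minor_def[abs_def] det_def by simp
qed

text \<open>
  Overwrites row and column \<open>a\<close> of \<open>M\<close> by the vector \<open>v\<close> with corner entry \<open>r\<close>.  Applied to the sufficient
  statistics of regressing the other coordinates on coordinate \<open>a\<close>, it recovers the scatter matrix.
\<close>

definition bordered :: "'p \<Rightarrow> real \<times> (real^'p) \<times> (real^'p^'p) \<Rightarrow> real^'p^'p" where
  "bordered a = (\<lambda>(r, v, M). \<chi> i j.
     if i = a then (if j = a then r else v $ j) else if j = a then v $ i else M $ i $ j)"

lemma linear_bordered: "linear (bordered a)"
  by (rule linearI) (auto simp: bordered_def vec_eq_iff)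

lemma measurable_bordered [measurable]: "bordered a \<in> borel_measurable borel"
  using linear_bordered
  by (intro borel_measurable_continuous_onI linear_continuous_on linear_conv_bounded_linear[THEN iffD1])

lemma outer_product_replace_coord:
  "outer_product (replace_coord a x y) (replace_coord a x y) = bordered a (x^2, x *\<^sub>R y, outer_product y y)"
  by (auto simp: outer_product_def replace_coord_def bordered_def vec_eq_iff power2_eq_square)

text \<open>
  The Schur complement of the corner in the scatter matrix is the residual matrix of the regression.
\<close>

lemma principal_minor_bordered:
  assumes "a \<notin> S" "fst z \<noteq> 0"
  shows "principal_minor (insert a S) (bordered a z) = fst z * principal_minor S (residual z)"
proof -
  obtain r v M where z: "z = (r, v, M)" by (cases z)
  define w :: "real^'a" where "w = (\<chi> i. if i \<in> S then v $ i else 0)"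
  define C :: "real^'a^'a" where "C = (\<chi> i j. if i \<in> S \<and> j \<in> S then M $ i $ j else if i = j then 1 else 0)"
  have "(\<chi> i j. if i \<in> insert a S \<and> j \<in> insert a S then bordered a z $ i $ j else if i = j then 1 else 0)
    = (\<chi> i j. if i = a then (if j = a then r else w $ j) else if j = a then w $ i else C $ i $ j)"
    by (auto simp: vec_eq_iff z bordered_def w_def C_def)
  moreover have "(\<chi> i j. if i \<in> S \<and> j \<in> S then residual z $ i $ j else if i = j then 1 else 0)
    = (\<chi> i j. if i = a \<or> j = a then (if i = j then 1 else 0) else C $ i $ j - w $ i * w $ j / r)"
    using assms(1) by (auto simp: vec_eq_iff z residual_def outer_product_def w_def C_def)
  moreover have "r \<noteq> 0" using assms(2) by (simp add: z)
  note det_schur_complement[OF this, of a w C]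
  ultimately show ?thesis
    unfolding principal_minor_def by (simp only: z fst_conv)
qed

interpretation bartlett: gaussian_design std_normal std_gauss
  by (rule gaussian_design.intro)
    (simp_all add: prob_space_std_normal AE_std_normal_nonzero prob_space_std_gauss rotation_invariant_std_gauss)

text \<open>
  Coordinate \<open>a\<close> is an independent normal variable, so it can act as the regressor for the others;
  as \<open>bordered\<close> is linear, it may be applied after summation.
\<close>

lemma wishart_eq_distr_bordered:
  "wishart std_gauss N = distr (iid_sum (scatter_increment std_normal std_gauss) N) borel (bordered a)"
proof -
  have "distr std_gauss borel (\<lambda>y. outer_product y y)
      = distr (scatter_increment std_normal std_gauss) borel (bordered a)"
  proof (rule measure_eqI)
    fix A assume "A \<in> sets (distr std_gauss borel (\<lambda>y::real^'a. outer_product y y))"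
    then have [measurable]: "A \<in> sets borel" by simp
    have "emeasure (distr std_gauss borel (\<lambda>y. outer_product y y)) A
        = (\<integral>\<^sup>+ y. indicator A (outer_product y y) \<partial>std_gauss)"
      by (subst nn_integral_indicator[symmetric], simp, subst nn_integral_distr) auto
    also have "\<dots> = (\<integral>\<^sup>+ x. \<integral>\<^sup>+ y. indicator A (bordered a (x^2, x *\<^sub>R y, outer_product y y)) \<partial>std_gauss \<partial>std_normal)"
      by (subst nn_integral_std_gauss_replace_coord[of _ a]) (simp_all add: outer_product_replace_coord)
    also have "\<dots> = (\<integral>\<^sup>+ z. indicator A (bordered a z) \<partial>scatter_increment std_normal std_gauss)"
      by (subst bartlett.nn_integral_scatter_increment) simp_all
    also have "\<dots> = emeasure (distr (scatter_increment std_normal std_gauss) borel (bordered a)) A"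
      by (subst nn_integral_indicator[symmetric], simp, subst nn_integral_distr) auto
    finally show "emeasure (distr std_gauss borel (\<lambda>y. outer_product y y)) A
      = emeasure (distr (scatter_increment std_normal std_gauss) borel (bordered a)) A" .
  qed simp
  then show ?thesis
    unfolding wishart_def
    by (simp add: distr_iid_sum_linear[OF bartlett.prob_scatter_increment _ linear_bordered])
qed

text \<open>
  One step of Bartlett's decomposition: the determinant is the sum of squares of the regressor times
  the minor of the residual matrix, and by \<open>nn_integral_regress\<close> these factors are independent.
\<close>

lemma mellin_wishart_insert:
  fixes S :: "'p::finite set"
  assumes "a \<notin> S"
  shows "(\<integral>\<^sup>+ A. mellin_kernel s (principal_minor (insert a S) A) \<partial>wishart std_gauss (Suc N))
    = (\<integral>\<^sup>+ r. mellin_kernel s r \<partial>chi_square (Suc N))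
      * (\<integral>\<^sup>+ A. mellin_kernel s (principal_minor S A) \<partial>wishart std_gauss N)"
proof -
  have "(\<integral>\<^sup>+ A. mellin_kernel s (principal_minor (insert a S) A) \<partial>wishart std_gauss (Suc N))
      = (\<integral>\<^sup>+ z. mellin_kernel s (principal_minor (insert a S) (bordered a z))
          \<partial>iid_sum (scatter_increment std_normal std_gauss) (Suc N))"
    by (subst wishart_eq_distr_bordered[of _ a], subst nn_integral_distr) simp_all
  also have "\<dots> = (\<integral>\<^sup>+ z. mellin_kernel s (fst z * principal_minor S (residual z))
          \<partial>iid_sum (scatter_increment std_normal std_gauss) (Suc N))"
    using bartlett.AE_scatter_pos
    by (intro nn_integral_cong_AE, eventually_elim) (simp add: principal_minor_bordered[OF assms])
  also have "\<dots> = (\<integral>\<^sup>+ r. \<integral>\<^sup>+ A. mellin_kernel s (r * principal_minor S A) \<partial>wishart std_gauss N \<partial>chi_square (Suc N))"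
    unfolding chi_square_def
    using bartlett.nn_integral_residual[of "\<lambda>(r, A). mellin_kernel s (r * principal_minor S A)" N] by simp
  also have "\<dots> = (\<integral>\<^sup>+ r. mellin_kernel s r * (\<integral>\<^sup>+ A. mellin_kernel s (principal_minor S A) \<partial>wishart std_gauss N) \<partial>chi_square (Suc N))"
    using AE_chi_square_nonneg
    by (intro nn_integral_cong_AE, eventually_elim) (simp add: mellin_kernel_mult nn_integral_cmult)
  also have "\<dots> = (\<integral>\<^sup>+ r. mellin_kernel s r \<partial>chi_square (Suc N))
      * (\<integral>\<^sup>+ A. mellin_kernel s (principal_minor S A) \<partial>wishart std_gauss N)"
    by (rule nn_integral_multc) simp
  finally show ?thesis .
qed

lemma mellin_wishart_minor:
  fixes S :: "'p::finite set"
  assumes "card S \<le> N"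
  shows "(\<integral>\<^sup>+ A. mellin_kernel s (principal_minor S A) \<partial>wishart std_gauss N)
    = (\<Prod>k<card S. \<integral>\<^sup>+ r. mellin_kernel s r \<partial>chi_square (N - k))"
  using finite[of S] assms
proof (induction S arbitrary: N rule: finite_induct)
  case empty
  interpret prob_space "wishart std_gauss N" by (rule bartlett.prob_wishart)
  have "emeasure (wishart (std_gauss :: (real^'p) measure) N) UNIV = 1"
    using emeasure_space_1 by (simp add: wishart_def)
  then show ?case by (simp add: mellin_kernel_def wishart_def)
next
  case (insert a S)
  then obtain N' where N: "N = Suc N'" by (cases N) auto
  show ?case
    unfolding N mellin_wishart_insert[OF insert.hyps(2)]
    using insert N by (simp add: prod.lessThan_Suc_shift del: prod.lessThan_Suc)
qed

lemma mellin_wishart: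
  assumes "CARD('p) < n" "0 < \<bar>s\<bar>" "\<bar>s\<bar> < 1 / 2"
  shows "(\<integral>\<^sup>+ A. mellin_kernel s (det A) \<partial>wishart (std_gauss :: (real^'p) measure) n)
    = ennreal (exp (\<Sum>k<CARD('p). s * ln 2 + (ln_Gamma (real (n - k) / 2 + s) - ln_Gamma (real (n - k) / 2))))"
proof -
  have "(\<integral>\<^sup>+ A. mellin_kernel s (det A) \<partial>wishart (std_gauss :: (real^'p) measure) n)
      = (\<Prod>k<CARD('p). \<integral>\<^sup>+ r. mellin_kernel s r \<partial>chi_square (n - k))"
    using mellin_wishart_minor[of "UNIV :: 'p set" n s] assms(1) by simp
  also have "\<dots> = (\<Prod>k<CARD('p). ennreal (exp (s * ln 2 + (ln_Gamma (real (n - k) / 2 + s) - ln_Gamma (real (n - k) / 2)))))"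
    using assms by (intro prod.cong refl mellin_chi_square) auto
  finally show ?thesis by (simp add: prod_ennreal exp_sum)
qed

section \<open>Centring the sample\<close>

interpretation centring: gaussian_design "return borel 1" std_gauss
proof (rule gaussian_design.intro)
  show "AE x in return borel (1::real). x \<noteq> 0" by (subst AE_return) simp_all
qed (simp_all add: prob_space_return prob_space_std_gauss rotation_invariant_std_gauss)

text \<open>
  Subtracting the sample mean is regression on the constant regressor \<open>1\<close>, which costs one observation.
\<close>

lemma (in prob_space) centred_scatter_wishart:
  fixes Z :: "nat \<Rightarrow> 'a \<Rightarrow> real^'p" and f :: "real^'p^'p \<Rightarrow> ennreal"
  assumes ind: "indep_vars (\<lambda>_. borel) Z {1..n + 1}"
    and Z: "\<And>k. k \<in> {1..n + 1} \<Longrightarrow> distr M borel (Z k) = std_gauss"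
    and [measurable]: "f \<in> borel_measurable borel"
  shows "(\<integral>\<^sup>+ \<omega>. f (residual (real (n + 1), \<Sum>k = 1..n + 1. Z k \<omega>,
      \<Sum>k = 1..n + 1. outer_product (Z k \<omega>) (Z k \<omega>))) \<partial>M) = (\<integral>\<^sup>+ A. f A \<partial>wishart std_gauss n)"
proof -
  define q where "q y = (1::real, y, outer_product y y)" for y :: "real^'p"
  have q [measurable]: "q \<in> borel_measurable borel" unfolding q_def[abs_def] by measurable
  define G where "G k \<omega> = q (Z k \<omega>)" for k \<omega>
  have Zm [measurable]: "random_variable borel (Z k)" if "k \<in> {1..n + 1}" for k
    using ind that by (auto simp: indep_vars_def)
  have G: "indep_vars (\<lambda>_. borel) G {1..n + 1}"
    unfolding G_def by (rule indep_vars_compose2[OF ind]) simp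
  have Gm [measurable]: "random_variable borel (G k)" if "k \<in> {1..n + 1}" for k
    using Zm[OF that] unfolding G_def by measurable
  have law_q: "distr std_gauss borel q = scatter_increment (return borel 1) std_gauss"
  proof (rule measure_eqI)
    fix A assume "A \<in> sets (distr std_gauss borel q)"
    then have [measurable]: "A \<in> sets borel" by simp
    have "emeasure (distr std_gauss borel q) A = (\<integral>\<^sup>+ y. indicator A (q y) \<partial>std_gauss)"
      by (subst nn_integral_indicator[symmetric], simp, subst nn_integral_distr) auto
    also have "\<dots> = (\<integral>\<^sup>+ z. indicator A z \<partial>scatter_increment (return borel 1) std_gauss)"
      by (subst centring.nn_integral_scatter_increment, simp, subst nn_integral_return) (simp_all add: q_def)
    finally show "emeasure (distr std_gauss borel q) A = emeasure (scatter_increment (return borel 1) std_gauss) A"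
      by simp
  qed simp
  have law: "distr M borel (G k) = scatter_increment (return borel 1) std_gauss" if "k \<in> {1..n + 1}" for k
  proof -
    have "distr M borel (G k) = distr (distr M borel (Z k)) borel q"
      using Zm[OF that] by (simp add: distr_distr comp_def G_def[abs_def])
    then show ?thesis by (simp add: Z[OF that] law_q)
  qed
  have [measurable]: "residual \<in> borel_measurable (borel :: (real \<times> (real^'p) \<times> (real^'p^'p)) measure)"
    unfolding residual_def case_prod_beta by measurable
  have sum: "(\<Sum>k = 1..n + 1. G k \<omega>) = (real (n + 1), \<Sum>k = 1..n + 1. Z k \<omega>,
      \<Sum>k = 1..n + 1. outer_product (Z k \<omega>) (Z k \<omega>))" for \<omega>
    by (simp add: G_def q_def sum_prod prod_eq_iff fst_sum snd_sum)
  have "(\<integral>\<^sup>+ \<omega>. f (residual (\<Sum>k = 1..n + 1. G k \<omega>)) \<partial>M)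
      = (\<integral>\<^sup>+ z. f (residual z) \<partial>distr M borel (\<lambda>\<omega>. \<Sum>k = 1..n + 1. G k \<omega>))"
    using Gm by (subst nn_integral_distr) (simp_all add: borel_measurable_sum)
  also have "distr M borel (\<lambda>\<omega>. \<Sum>k = 1..n + 1. G k \<omega>)
      = iid_sum (scatter_increment (return borel 1) std_gauss) (Suc n)"
    using distr_sum_indep_identical[OF G law] by (simp only: Suc_eq_plus1)
  also have "(\<integral>\<^sup>+ z. f (residual z) \<partial>iid_sum (scatter_increment (return borel 1) std_gauss) (Suc n))
      = (\<integral>\<^sup>+ r. \<integral>\<^sup>+ A. f A \<partial>wishart std_gauss n \<partial>iid_sum (distr (return borel 1) borel (\<lambda>x::real. x^2)) (Suc n))"
    using centring.nn_integral_residual[of "\<lambda>(r, A). f A" n] by (simp del: iid_sum.simps)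
  also have "\<dots> = (\<integral>\<^sup>+ A. f A \<partial>wishart std_gauss n)"
    using prob_space.emeasure_space_1[OF prob_space_iid_sum[OF centring.prob_square, of "Suc n"]]
    by (simp del: iid_sum.simps)
  finally show ?thesis unfolding sum .
qed


lemma sum_centred_products:
  fixes a b :: "nat \<Rightarrow> real"
  assumes "N > 0"
  shows "(\<Sum>k = 1..N. (a k - (\<Sum>k = 1..N. a k) / real N) * (b k - (\<Sum>k = 1..N. b k) / real N))
    = (\<Sum>k = 1..N. a k * b k) - 1 / real N * ((\<Sum>k = 1..N. a k) * (\<Sum>k = 1..N. b k))"
proof -
  define s t where "s = (\<Sum>k = 1..N. a k)" and "t = (\<Sum>k = 1..N. b k)"
  have "(\<Sum>k = 1..N. (a k - s / real N) * (b k - t / real N))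
      = (\<Sum>k = 1..N. a k * b k) - (\<Sum>k = 1..N. a k) * (t / real N) - s / real N * (\<Sum>k = 1..N. b k)
        + real N * (s / real N * (t / real N))"
    by (simp add: algebra_simps sum.distrib sum_subtractf sum_distrib_left sum_distrib_right)
  also have "\<dots> = (\<Sum>k = 1..N. a k * b k) - 1 / real N * (s * t)"
    unfolding s_def[symmetric] t_def[symmetric] using assms by (simp add: field_simps)
  finally show ?thesis by (simp only: s_def t_def)
qed

text \<open>
  Translation by \<open>\<mu>\<close> cancels in the centred scatter matrix, and \<open>A\<close> acts on it by congruence.
\<close>

lemma residual_whitened_sample:
  fixes x :: "nat \<Rightarrow> real^'p" and \<mu> :: "real^'p" and A :: "real^'p^'p"
  assumes "n > 0"
  shows "residual (real (n + 1), \<Sum>k = 1..n + 1. A *v (x k - \<mu>),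
      \<Sum>k = 1..n + 1. outer_product (A *v (x k - \<mu>)) (A *v (x k - \<mu>)))
    = A ** (real n *\<^sub>R sample_covariance n x) ** transpose A"
proof -
  define y where "y k = x k - \<mu>" for k
  define F where "F M = A ** M ** transpose A" for M :: "real^'p^'p"
  have F: "linear F"
    unfolding F_def by (rule linearI) (simp_all add: vec_eq_iff matrix_matrix_mult_def distrib_left distrib_right sum.distrib
        sum_distrib_left sum_distrib_right mult_ac)
  have mean: "x k - sample_mean n x = y k - (1 / real (n + 1)) *\<^sub>R (\<Sum>k = 1..n + 1. y k)" for k
  proof -
    have "(\<Sum>k = 1..n + 1. y k) = (\<Sum>k = 1..n + 1. x k) - real (n + 1) *\<^sub>R \<mu>"
      unfolding y_def sum_subtractf sum_constant_scaleR by simp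
    moreover have "1 / real (n + 1) * real (n + 1) = 1" by simp
    ultimately have "(1 / real (n + 1)) *\<^sub>R (\<Sum>k = 1..n + 1. y k) = sample_mean n x - \<mu>"
      by (simp only: sample_mean_def scaleR_diff_right scaleR_scaleR scaleR_one)
    then show ?thesis by (simp only: y_def) simp
  qed
  have "real n *\<^sub>R sample_covariance n x
      = (\<Sum>k = 1..n + 1. outer_product (y k) (y k))
        - (1 / real (n + 1)) *\<^sub>R outer_product (\<Sum>k = 1..n + 1. y k) (\<Sum>k = 1..n + 1. y k)"
  proof -
    have "(\<Sum>k = 1..n + 1. (y k - (1 / real (n + 1)) *\<^sub>R (\<Sum>k = 1..n + 1. y k)) $ i * (y k - (1 / real (n + 1)) *\<^sub>R (\<Sum>k = 1..n + 1. y k)) $ j)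
      = (\<Sum>k = 1..n + 1. y k $ i * y k $ j) - 1 / real (n + 1) * ((\<Sum>k = 1..n + 1. y k) $ i * (\<Sum>k = 1..n + 1. y k) $ j)" for i j
      using sum_centred_products[of "n + 1" "\<lambda>k. y k $ i" "\<lambda>k. y k $ j"]
      by (simp only: sum_component vector_minus_component vector_scaleR_component) simp
    then show ?thesis
      using assms unfolding sample_covariance_def mean
      by (simp only: vec_eq_iff outer_product_def sum_component vec_lambda_beta vector_minus_component
          vector_scaleR_component) simp
  qed
  then have "F (real n *\<^sub>R sample_covariance n x)
      = (\<Sum>k = 1..n + 1. F (outer_product (y k) (y k)))
        - (1 / real (n + 1)) *\<^sub>R F (outer_product (\<Sum>k = 1..n + 1. y k) (\<Sum>k = 1..n + 1. y k))"
    by (simp only: linear_diff[OF F] linear_sum[OF F] linear_scale[OF F])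
  moreover have "A *v (\<Sum>k = 1..n + 1. y k) = (\<Sum>k = 1..n + 1. A *v y k)"
    by (rule linear_sum[OF matrix_vector_mul_linear])
  ultimately show ?thesis
    by (simp only: F_def outer_product_linear_image[symmetric] residual_def prod.case y_def)
qed

section \<open>The mean square error\<close>

text \<open>
  In the application \<open>E\<close> is a mean square error, which is not known to be finite beforehand; the
  hypothesis at a single \<open>s\<close> shows that it is.
\<close>

lemma second_moment_le_of_mellin_bound:
  fixes E :: ennreal and g g' :: "real \<Rightarrow> real"
  assumes "\<delta> > 0" and g: "\<And>s. \<bar>s\<bar> < \<delta> \<Longrightarrow> (g has_real_derivative g' s) (at s)"
    and "g 0 = 0" "g' 0 = 0" and g'': "(g' has_real_derivative V) (at 0)"
    and bound: "\<And>s. 0 < s \<Longrightarrow> s < \<delta> \<Longrightarrow> ennreal (s^2) * E + 2 \<le> ennreal (exp (g s)) + ennreal (exp (g (- s)))"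
  shows "E \<le> ennreal V"
proof -
  have "E \<noteq> \<infinity>"
  proof
    assume "E = \<infinity>"
    then show False
      using bound[of "\<delta> / 2"] assms(1) by (simp add: ennreal_mult_top top_unique flip: ennreal_plus)
  qed
  then obtain e where e: "e \<ge> 0" "E = ennreal e" by (cases E) auto
  have "eventually (\<lambda>s. e \<le> (exp (g s) + exp (g (- s)) - 2) / s^2) (at_right 0)"
    unfolding eventually_at_right_field
  proof (intro exI[of _ \<delta>] conjI allI impI)
    fix s assume s: "0 < s" "s < \<delta>"
    have "ennreal (s^2 * e + 2) = ennreal (s^2) * E + 2"
      using e by (simp add: ennreal_mult' ennreal_plus)
    also have "\<dots> \<le> ennreal (exp (g s) + exp (g (- s)))"
      using bound[OF s] by (simp add: ennreal_plus)
    finally have "s^2 * e + 2 \<le> exp (g s) + exp (g (- s))"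
      by (subst (asm) ennreal_le_iff) (auto intro: add_nonneg_nonneg)
    then show "e \<le> (exp (g s) + exp (g (- s)) - 2) / s^2"
      using s by (simp add: field_simps)
  qed (use assms(1) in simp)
  then have "e \<le> V"
    by (intro tendsto_lowerbound[OF symmetric_exp_difference_quotient[OF assms(1-5)]]) auto
  then show ?thesis using e by (simp add: ennreal_leI)
qed

text \<open>
  The bound \<open>square_le_exp_sum\<close> at \<open>s (ln d - m)\<close>; for \<open>d \<le> 0\<close>, where \<open>ln d\<close> has no meaning, the
  right-hand side is infinite.
\<close>

lemma square_le_mellin_kernels:
  assumes "s > 0"
  shows "ennreal (s^2) * ennreal ((ln d - m)^2) + 2
    \<le> ennreal (exp (- s * m)) * mellin_kernel s d + ennreal (exp (s * m)) * mellin_kernel (- s) d"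
proof (cases "d > 0")
  case True
  have "ennreal (s^2) * ennreal ((ln d - m)^2) + 2 = ennreal ((s * (ln d - m))^2 + 2)"
    by (simp add: ennreal_mult'[symmetric] power_mult_distrib ennreal_plus)
  also have "\<dots> \<le> ennreal (exp (s * (ln d - m)) + exp (- (s * (ln d - m))))"
    by (rule ennreal_leI[OF square_le_exp_sum])
  also have "\<dots> = ennreal (exp (- s * m)) * mellin_kernel s d + ennreal (exp (s * m)) * mellin_kernel (- s) d"
    using True by (simp add: mellin_kernel_def ennreal_mult'[symmetric] powr_def exp_add[symmetric] algebra_simps flip: ennreal_plus)
  finally show ?thesis .
qed (simp add: mellin_kernel_def ennreal_mult_top)

theorem theorem2:
  fixes M :: "'a measure"
    and n :: nat
    and X :: "nat \<Rightarrow> 'a \<Rightarrow> real^'p"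
    and \<mu> :: "real^'p"
    and \<Sigma> :: "real^'p^'p"
  assumes "prob_space M"
    and "CARD('p) \<le> n"
    and "positive_definite \<Sigma>"
    and "prob_space.indep_vars M (\<lambda>_. borel) X {1..n + 1}"
    and "\<And>k. k \<in> {1..n + 1} \<Longrightarrow>
           distributed M lborel (X k) (\<lambda>x. ennreal (mvnormal_density \<mu> \<Sigma> x))"
  shows "(\<integral>\<^sup>+ \<omega>. ennreal ((log_det_estimator n (\<lambda>k. X k \<omega>) - ln (det \<Sigma>))\<^sup>2) \<partial>M)
     \<le> (if CARD('p) = n then \<infinity>
        else ennreal (- 2 * ln (1 - real CARD('p) / real n)
               + 10 * real CARD('p) / (3 * real n) * (1 / (real n - real CARD('p)))))"
proof (cases "CARD('p) = n")
  case False
  define p where "p = CARD('p)"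
  have pn: "p < n" using False assms(2) by (simp add: p_def)
  interpret prob_space M by fact
  obtain B :: "real^'p^'p" where B: "transpose B ** \<Sigma> ** B = mat 1"
    using orthonormal_wrt_positive_definite[OF assms(3)] .
  have det\<Sigma>: "det \<Sigma> > 0" using det_whitening[OF B] by simp
  define Z where "Z k \<omega> = transpose B *v (X k \<omega> - \<mu>)" for k \<omega>
  have whiten: "(\<lambda>x. transpose B *v (x - \<mu>)) \<in> borel_measurable borel"
    by (intro borel_measurable_continuous_onI bounded_linear.continuous_on[OF matrix_vector_mul_bounded_linear]
        continuous_intros)
  have ind: "indep_vars (\<lambda>_. borel) Z {1..n + 1}"
    unfolding Z_def by (rule indep_vars_compose2[OF assms(4)]) (rule whiten)
  have lawZ: "distr M borel (Z k) = std_gauss" if "k \<in> {1..n + 1}" for k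
    unfolding Z_def[abs_def] by (rule distr_whitened_normal[OF B assms(5)[OF that]])
  have [measurable]: "X k \<in> borel_measurable M" if "k \<in> {1..n + 1}" for k
    using assms(4) that by (auto simp: indep_vars_def)
  have [measurable]: "(\<lambda>\<omega>. det (sample_covariance n (\<lambda>k. X k \<omega>))) \<in> borel_measurable M"
  proof -
    have "(\<lambda>\<omega>. principal_minor UNIV (sample_covariance n (\<lambda>k. X k \<omega>))) \<in> borel_measurable M"
      unfolding sample_covariance_def sample_mean_def by measurable
    then show ?thesis by simp
  qed
  define d where "d \<omega> = real n ^ p * det (sample_covariance n (\<lambda>k. X k \<omega>)) / det \<Sigma>" for \<omega>
  have d [measurable]: "d \<in> borel_measurable M" unfolding d_def by measurable
  have d_eq: "d \<omega> = det (residual (real (n + 1), \<Sum>k = 1..n + 1. Z k \<omega>,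
      \<Sum>k = 1..n + 1. outer_product (Z k \<omega>) (Z k \<omega>)))" for \<omega>
    using residual_whitened_sample[of n "transpose B" "\<lambda>k. X k \<omega>" \<mu>] pn
    by (simp add: d_def Z_def det_mul det_scaleR_matrix det_whitening[OF B] p_def power2_eq_square)
  define a where "a k = real (n - k) / 2" for k
  have a: "a k \<ge> 1 / 2" if "k < p" for k using that pn by (simp add: a_def)
  define m where "m = (\<Sum>k<p. Digamma (a k) + ln 2)"
  define g where "g s = (\<Sum>k<p. ln_Gamma (a k + s) - ln_Gamma (a k) - s * Digamma (a k))" for s
  define g' where "g' s = (\<Sum>k<p. Digamma (a k + s) - Digamma (a k))" for s
  define V where "V = (\<Sum>k<p. Polygamma 1 (a k))"
  have moment: "ennreal (exp (- s * m)) * (\<integral>\<^sup>+ \<omega>. mellin_kernel s (d \<omega>) \<partial>M) = ennreal (exp (g s))"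
    if "0 < \<bar>s\<bar>" "\<bar>s\<bar> < 1 / 2" for s
  proof -
    have [measurable]: "(\<lambda>A. mellin_kernel s (det A)) \<in> borel_measurable (borel :: (real^'p^'p) measure)"
      using measurable_compose[OF measurable_principal_minor[of UNIV] borel_measurable_mellin_kernel] by simp
    have "(\<integral>\<^sup>+ \<omega>. mellin_kernel s (d \<omega>) \<partial>M) = (\<integral>\<^sup>+ A. mellin_kernel s (det A) \<partial>wishart (std_gauss :: (real^'p) measure) n)"
      unfolding d_eq by (rule centred_scatter_wishart[OF ind lawZ]) simp_all
    also have "\<dots> = ennreal (exp (\<Sum>k<p. s * ln 2 + (ln_Gamma (a k + s) - ln_Gamma (a k))))"
      unfolding p_def a_def by (rule mellin_wishart) (use that pn in \<open>simp_all add: p_def\<close>)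
    finally show ?thesis
      by (simp add: ennreal_mult'[symmetric] exp_add[symmetric] m_def g_def sum.distrib sum_subtractf
          sum_negf sum_distrib_left algebra_simps)
  qed
  \<comment> \<open>the bias correction is \<open>m - p ln n\<close>; the factor \<open>n\<^sup>p\<close> in \<open>d\<close> accounts for \<open>p ln n\<close>\<close>
  have estimator: "(log_det_estimator n (\<lambda>k. X k \<omega>) - ln (det \<Sigma>))^2 = (ln (d \<omega>) - m)^2" if "d \<omega> > 0" for \<omega>
  proof -
    have pos: "det (sample_covariance n (\<lambda>k. X k \<omega>)) > 0"
      using that det\<Sigma> pn by (simp add: d_def zero_less_mult_iff zero_less_divide_iff)
    have "bias_correction n p = (\<Sum>k<p. Digamma (a k) - ln (real n / 2))"
      unfolding bias_correction_def
      by (rule sum.reindex_bij_witness[of _ Suc "\<lambda>k. k - 1"]) (use pn in \<open>auto simp: a_def of_nat_diff algebra_simps\<close>)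
    also have "\<dots> = m - real p * ln (real n)"
      using pn by (simp add: m_def sum_subtractf sum.distrib ln_div algebra_simps)
    finally have "log_det_estimator n (\<lambda>k. X k \<omega>) - ln (det \<Sigma>) = ln (d \<omega>) - m"
      using pos det\<Sigma> pn by (simp add: log_det_estimator_def p_def[symmetric] d_def ln_mult ln_div ln_realpow)
    then show ?thesis by simp
  qed
  \<comment> \<open>any admissible exponent would do\<close>
  have d_pos: "AE \<omega> in M. d \<omega> > 0"
  proof -
    have "(\<integral>\<^sup>+ \<omega>. mellin_kernel (1 / 4) (d \<omega>) \<partial>M) \<noteq> \<infinity>"
      using moment[of "1 / 4"] by (auto simp: ennreal_mult_top)
    then have "AE \<omega> in M. mellin_kernel (1 / 4) (d \<omega>) \<noteq> \<infinity>"
      by (intro nn_integral_PInf_AE) simp_all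
    then show ?thesis by eventually_elim (simp add: mellin_kernel_def split: if_splits)
  qed
  have "(\<integral>\<^sup>+ \<omega>. ennreal ((log_det_estimator n (\<lambda>k. X k \<omega>) - ln (det \<Sigma>))\<^sup>2) \<partial>M)
      = (\<integral>\<^sup>+ \<omega>. ennreal ((ln (d \<omega>) - m)^2) \<partial>M)"
    using d_pos by (intro nn_integral_cong_AE, eventually_elim) (simp add: estimator)
  also have "\<dots> \<le> ennreal V"
  proof (rule second_moment_le_of_mellin_bound[of "1 / 2" g g'])
    show "(g has_real_derivative g' s) (at s)" if "\<bar>s\<bar> < 1 / 2" for s
      unfolding g_def g'_def
    proof (rule DERIV_sum)
      fix k assume "k \<in> {..<p}"
      then have "a k + s > 0" using a[of k] that by auto
      then show "((\<lambda>s. ln_Gamma (a k + s) - ln_Gamma (a k) - s * Digamma (a k)) has_real_derivative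
          Digamma (a k + s) - Digamma (a k)) (at s)"
        by (auto intro!: derivative_eq_intros DERIV_chain2[OF has_field_derivative_ln_Gamma_real])
    qed
    show "(g' has_real_derivative V) (at 0)"
      unfolding g'_def V_def
    proof (rule DERIV_sum)
      fix k assume "k \<in> {..<p}"
      then have "a k > 0" using a[of k] by auto
      then show "((\<lambda>s. Digamma (a k + s) - Digamma (a k)) has_real_derivative Polygamma 1 (a k)) (at 0)"
        by (auto intro!: derivative_eq_intros elim!: nonpos_Ints_cases)
    qed
    show "ennreal (s^2) * (\<integral>\<^sup>+ \<omega>. ennreal ((ln (d \<omega>) - m)^2) \<partial>M) + 2 \<le> ennreal (exp (g s)) + ennreal (exp (g (- s)))"
      if "0 < s" "s < 1 / 2" for s
    proof -
      have "ennreal (s^2) * (\<integral>\<^sup>+ \<omega>. ennreal ((ln (d \<omega>) - m)^2) \<partial>M) + 2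
          = (\<integral>\<^sup>+ \<omega>. ennreal (s^2) * ennreal ((ln (d \<omega>) - m)^2) + 2 \<partial>M)"
        by (simp add: nn_integral_add nn_integral_cmult emeasure_space_1)
      also have "\<dots> \<le> (\<integral>\<^sup>+ \<omega>. ennreal (exp (- s * m)) * mellin_kernel s (d \<omega>)
          + ennreal (exp (s * m)) * mellin_kernel (- s) (d \<omega>) \<partial>M)"
        by (intro nn_integral_mono square_le_mellin_kernels that)
      also have "\<dots> = ennreal (exp (g s)) + ennreal (exp (g (- s)))"
        using moment[of s] moment[of "- s"] that by (simp add: nn_integral_add nn_integral_cmult)
      finally show ?thesis .
    qed
  qed (simp_all add: g_def g'_def)
  also have "V = (\<Sum>k = 1..p. Polygamma 1 ((real n - real k + 1) / 2))"
    unfolding V_def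
    by (rule sum.reindex_bij_witness[of _ "\<lambda>k. k - 1" Suc]) (use pn in \<open>auto simp: a_def of_nat_diff algebra_simps\<close>)
  also have "ennreal \<dots> \<le> ennreal (- 2 * ln (1 - real p / real n) + 10 * real p / (3 * real n) * (1 / (real n - real p)))"
    by (rule ennreal_leI[OF sum_trigamma_upper_bound[OF pn]])
  finally show ?thesis using False by (simp add: p_def)
qed simp

end
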